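(* Let $\tau>0$ and let $(\gamma_n)_{n\ge1}$ be a nonincreasing sequence of positive step-sizes with $\sum_{n=1}^{\infty}\gamma_n^2<\infty$ and $\sum_{n=1}^{\infty}\gamma_n=\infty$. Let $\mathbf{Y}(n),\mathbf{X}(n)$ be generated from an initial Hermitian matrix $\mathbf{Y}(1)$, $\mathbf{X}(1)=\exp(\mathbf{Y}(1))/\operatorname{tr}[\exp(\mathbf{Y}(1))]$, by $$\mathbf{Y}(n+1)=\mathbf{Y}(n)-\gamma_n\big(\hat{\mathbf{V}}(n)+\tau\mathbf{Y}(n)\big),\qquad \mathbf{X}(n+1)=\frac{\exp(\mathbf{Y}(n+1))}{\operatorname{tr}[\exp(\mathbf{Y}(n+1))]},$$ where the random Hermitian matrices $\hat{\mathbf{V}}(n)$ are uniformly bounded (there is a constant $C$ with $\|\hat{\mathbf{V}}(n)\|\le C$ almost surely for all $n$) and satisfy $\mathbb{E}[\hat{\mathbf{V}}(n)\mid\mathcal{F}_n]=\mathbf{V}(\mathbf{X}(n))$ for all $n\ge1$. Then, almost surely, $\mathbf{X}(n)$ converges to a solution of the perturbed problem $$\text{minimize } F(\mathbf{X})+\tau\operatorname{tr}[\mathbf{X}\log\mathbf{X}]\quad\text{subject to } \mathbf{X}\in\mathcal{X}.$$ In particular, there is a function $\varepsilon(\tau)$ with $\varepsilon(\tau)\to0$ as $\tau\to0^+$ such that, for every $\tau>0$, the iterates $\mathbf{X}(n)$ converge almost surely to a point within distance $\varepsilon(\tau)$ of a solution of the stochastic problem: minimize $\mathbb{E}[f(\mathbf{X};\omega)]$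 subject to $\mathbf{X}\in\mathcal{X}$.
   Context: $\mathcal{H}_M$ is the real vector space of $M\times M$ complex Hermitian matrices with any fixed norm, and $\mathcal{X}=\{\mathbf{X}\in\mathcal{H}_M:\mathbf{X}\succeq0,\ \operatorname{tr}(\mathbf{X})=1\}$. $\omega$ is a random variable with values in a probability space $\Omega$; $f:\mathcal{X}\times\Omega\to\mathbb{R}$ is a random function which is smooth and convex in $\mathbf{X}\in\mathcal{X}$ for all $\omega\in\Omega$. The mean objective $F(\mathbf{X})=\mathbb{E}[f(\mathbf{X};\omega)]$ (which is convex) is assumed finite and smooth over $\mathcal{X}$, and $\mathbf{V}(\mathbf{X})=\nabla_{\mathbf{X}}F(\mathbf{X})$ is its (Hermitian) gradient with respect to the pairing $\operatorname{tr}(\mathbf{A}\mathbf{B})$. $\mathcal{F}_n$ is the filtration induced by the history $\mathbf{X}(1),\dots,\mathbf{X}(n)$. By convention $0\log0=0$ in $\operatorname{tr}[\mathbf{X}\log\mathbf{X}]$. *)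

theory Defs
  imports "HOL-Probability.Probability"
begin

text \<open>
  \<open>M \<times> M\<close> complex matrices are elements of \<open>complex^'n^'n\<close> with \<open>M = CARD('n)\<close>. The type-class
  operations \<open>*\<close>, \<open>^\<close> on this type are componentwise, so the matrix product is \<open>**\<close> throughout and
  the exponential is defined below from its power series.
\<close>

definition adj :: "complex^'n^'n \<Rightarrow> complex^'n^'n" where
  "adj A = (\<chi> i j. cnj (A $ j $ i))"

definition hermitian :: "complex^'n^'n \<Rightarrow> bool" where
  "hermitian A \<longleftrightarrow> adj A = A"

definition psd :: "complex^'n^'n \<Rightarrow> bool" where
  "psd A \<longleftrightarrow> hermitian A \<and> (\<forall>v. 0 \<le> Re (\<Sum>i\<in>UNIV. cnj (v $ i) * (A *v v) $ i))"

definition spectrahedron :: "(complex^'n^'n) set" where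
  "spectrahedron = {X. psd X \<and> trace X = 1}"

text \<open>An arbitrary norm on the real vector space of Hermitian matrices; its values elsewhere are
  irrelevant. Nonnegativity follows from the three clauses.\<close>

definition hermitian_norm :: "(complex^'n^'n \<Rightarrow> real) \<Rightarrow> bool" where
  "hermitian_norm N \<longleftrightarrow>
     (\<forall>A. hermitian A \<longrightarrow> (N A = 0 \<longleftrightarrow> A = 0)) \<and>
     (\<forall>A c. hermitian A \<longrightarrow> N (c *\<^sub>R A) = \<bar>c\<bar> * N A) \<and>
     (\<forall>A B. hermitian A \<longrightarrow> hermitian B \<longrightarrow> N (A + B) \<le> N A + N B)"

definition mexp :: "complex^'n^'n \<Rightarrow> complex^'n^'n" where
  "mexp A = (\<Sum>k. (1 / fact k) *\<^sub>R (((**) A ^^ k) (mat 1)))"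

definition unitary :: "complex^'n^'n \<Rightarrow> bool" where
  "unitary U \<longleftrightarrow> U ** adj U = mat 1 \<and> adj U ** U = mat 1"

definition diag :: "('n \<Rightarrow> real) \<Rightarrow> complex^'n^'n" where
  "diag d = (\<chi> i j. if i = j then complex_of_real (d i) else 0)"

text \<open>Functional calculus for Hermitian matrices: \<open>\<phi>\<close> is applied to the eigenvalues. The result does
  not depend on the chosen diagonalisation.\<close>

definition spectral_fun :: "(real \<Rightarrow> real) \<Rightarrow> complex^'n^'n \<Rightarrow> complex^'n^'n" where
  "spectral_fun \<phi> A =
     (THE B. \<exists>U d. unitary U \<and> A = U ** diag d ** adj U \<and> B = U ** diag (\<phi> \<circ> d) ** adj U)"

definition mlog :: "complex^'n^'n \<Rightarrow> complex^'n^'n" where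
  "mlog = spectral_fun ln"

text \<open>\<open>tr[X log X]\<close>, which is real for positive semidefinite \<open>X\<close>. On the kernel of \<open>X\<close> the (real)
  value \<open>ln 0\<close> is multiplied by the eigenvalue \<open>0\<close>, which is the convention \<open>0 log 0 = 0\<close>.\<close>

definition neg_entropy :: "complex^'n^'n \<Rightarrow> real" where
  "neg_entropy X = Re (trace (X ** mlog X))"

text \<open>\<open>G\<close> is a Hermitian gradient field of \<open>g\<close> on the spectrahedron for the pairing \<open>tr(A B)\<close>. As \<open>g\<close>
  is only considered on the spectrahedron, the derivative is taken within it. This set has empty
  interior in the Hermitian matrices, so \<open>G X\<close> is determined only up to real multiples of the
  identity; every representative is admitted, in particular the gradient of any extension of \<open>g\<close>.\<close>

definition is_gradient :: "(complex^'n^'n \<Rightarrow> real) \<Rightarrow> (complex^'n^'n \<Rightarrow> complex^'n^'n) \<Rightarrow> bool" where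
  "is_gradient g G \<longleftrightarrow>
     (\<forall>X\<in>spectrahedron. hermitian (G X) \<and>
        (g has_derivative (\<lambda>H. Re (trace (G X ** H)))) (at X within spectrahedron))"

text \<open>``Smooth'' is read as continuously differentiable, the weakest of the usual meanings.\<close>

definition smooth_on_spectrahedron :: "(complex^'n^'n \<Rightarrow> real) \<Rightarrow> bool" where
  "smooth_on_spectrahedron g \<longleftrightarrow> (\<exists>G. is_gradient g G \<and> continuous_on spectrahedron G)"

definition mean_objective :: "'w measure \<Rightarrow> (complex^'n^'n \<Rightarrow> 'w \<Rightarrow> real) \<Rightarrow> complex^'n^'n \<Rightarrow> real" where
  "mean_objective D f X = (\<integral>w. f X w \<partial>D)"

text \<open>The trace in the denominator is real and positive for Hermitian \<open>Y\<close>.\<close>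

definition gibbs :: "complex^'n^'n \<Rightarrow> complex^'n^'n" where
  "gibbs Y = (1 / Re (trace (mexp Y))) *\<^sub>R mexp Y"

definition history :: "'a measure \<Rightarrow> (nat \<Rightarrow> 'a \<Rightarrow> complex^'n^'n) \<Rightarrow> nat \<Rightarrow> 'a measure" where
  "history P X n = sigma (space P) (\<Union>k\<in>{1..n}. {X k -` B \<inter> space P | B. B \<in> sets borel})"

definition matrix_cond_exp ::
  "'a measure \<Rightarrow> 'a measure \<Rightarrow> ('a \<Rightarrow> complex^'n^'n) \<Rightarrow> 'a \<Rightarrow> complex^'n^'n" where
  "matrix_cond_exp P F W \<omega> =
     (\<chi> i j. Complex (real_cond_exp P F (\<lambda>\<omega>. Re (W \<omega> $ i $ j)) \<omega>)
                      (real_cond_exp P F (\<lambda>\<omega>. Im (W \<omega> $ i $ j)) \<omega>))"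

text \<open>The iteration on a probability space \<open>P\<close>. Time starts at \<open>1\<close>; values at index \<open>0\<close> are
  unconstrained and unused.\<close>

locale matrix_exp_learning = prob_space P
  for P :: "'a measure" +
  fixes N :: "complex^'n^'n \<Rightarrow> real"
    and V :: "complex^'n^'n \<Rightarrow> complex^'n^'n"
    and \<tau> :: real
    and \<gamma> :: "nat \<Rightarrow> real"
    and Vhat Y X :: "nat \<Rightarrow> 'a \<Rightarrow> complex^'n^'n"
  assumes tau_pos: "\<tau> > 0"
    and step_pos: "\<And>n. n \<ge> 1 \<Longrightarrow> \<gamma> n > 0"
    and step_noninc: "\<And>n. n \<ge> 1 \<Longrightarrow> \<gamma> (n + 1) \<le> \<gamma> n"
    and step_square_summable: "summable (\<lambda>n. (\<gamma> (n + 1))\<^sup>2)"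
    and step_sum_infinite: "filterlim (\<lambda>n. \<Sum>k=1..n. \<gamma> k) at_top sequentially"
    and Y_init: "\<exists>Y1. hermitian Y1 \<and> (\<forall>\<omega>\<in>space P. Y 1 \<omega> = Y1)"
    and Y_step: "\<And>n \<omega>. n \<ge> 1 \<Longrightarrow> \<omega> \<in> space P \<Longrightarrow>
                   Y (n + 1) \<omega> = Y n \<omega> - \<gamma> n *\<^sub>R (Vhat n \<omega> + \<tau> *\<^sub>R Y n \<omega>)"
    and X_gibbs: "\<And>n \<omega>. n \<ge> 1 \<Longrightarrow> \<omega> \<in> space P \<Longrightarrow> X n \<omega> = gibbs (Y n \<omega>)"
    and Vhat_measurable: "\<And>n. n \<ge> 1 \<Longrightarrow> Vhat n \<in> borel_measurable P"
    and Vhat_hermitian: "\<And>n \<omega>. n \<ge> 1 \<Longrightarrow> \<omega> \<in> space P \<Longrightarrow> hermitian (Vhat n \<omega>)"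
    and Vhat_bounded: "\<exists>C. \<forall>n\<ge>1. AE \<omega> in P. N (Vhat n \<omega>) \<le> C"
    and Vhat_unbiased: "\<And>n. n \<ge> 1 \<Longrightarrow>
          AE \<omega> in P. matrix_cond_exp P (history P X n) (Vhat n) \<omega> = V (X n \<omega>)"

end

theory Submission
  imports Defs
begin

text \<open>
  The Frobenius inner product \<open>A \<bullet> B\<close> of Hermitian matrices is the trace pairing \<open>tr(A B)\<close>, so the
  argument can be run in the Euclidean space of matrices, with the relative entropy
  \<open>D(p, X) = tr[p (log p - log X)]\<close> as Lyapunov function. Three facts carry it.

  First, everything about the matrix exponential and logarithm follows from one inequality,
  \<open>D(A, X) \<ge> |A - X|\<^sup>2 / 2\<close> (\<open>rel_entropy_gibbs_lower_bound\<close>), proved by expanding both sides in the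
  eigenbases of \<open>A\<close> and \<open>X\<close>. For \<open>X = gibbs Y\<close> and \<open>X' = gibbs Y'\<close> one has
  \<open>D(X, X') + D(X', X) = (Y - Y') \<bullet> (X - X')\<close>; hence the Gibbs map is \<open>1\<close>-Lipschitz and
  \<open>D(X, X') \<le> |Y - Y'|\<^sup>2\<close>.

  Secondly, Brouwer's theorem provides a point \<open>p\<close> with \<open>p = gibbs (- \<nabla>F(p) / \<tau>)\<close>. Convexity of \<open>F\<close>
  makes it a minimiser of \<open>F + \<tau> tr[X log X]\<close>, and monotonicity of the gradient gives the drift
  estimate \<open>(V(X) + \<tau> Y) \<bullet> (X - p) \<ge> \<tau> D(p, X)\<close> (\<open>gibbs_equilibrium_drift\<close>).

  Thirdly, the regularisation keeps the dual iterates \<open>Y(n)\<close> bounded, so the three-point identity for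
  \<open>D\<close> turns the iteration into
  \<open>D\<^sub>n\<^sub>+\<^sub>1 \<le> (1 - \<tau> \<gamma>\<^sub>n) D\<^sub>n - \<gamma>\<^sub>n \<xi>\<^sub>n + B \<gamma>\<^sub>n\<^sup>2\<close> for \<open>D\<^sub>n = D(p, X(n))\<close> and a noise term \<open>\<xi>\<^sub>n\<close> that has mean
  zero on every event of the history. Since \<open>\<Sum> \<gamma>\<^sub>n = \<infinity>\<close> and \<open>\<Sum> \<gamma>\<^sub>n\<^sup>2 < \<infinity>\<close>, the expectations of \<open>D\<^sub>n\<close> tend
  to zero. Moreover \<open>D\<^sub>n + B \<Sum>\<^sub>k\<^sub>\<ge>\<^sub>n \<gamma>\<^sub>k\<^sup>2\<close> is a nonnegative supermartingale whose expectation tends to zero,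
  so Ville's maximal inequality yields \<open>D\<^sub>n \<longlonglongrightarrow> 0\<close> almost surely, and then \<open>X(n) \<longlonglongrightarrow> p\<close>.

  For the second claim, the entropy is bounded on the spectrahedron, so by compactness the distance
  of \<open>p = p(\<tau>)\<close> from the set of minimisers of \<open>F\<close> vanishes as \<open>\<tau> \<longlongrightarrow> 0\<close>; up to a constant that compares
  the given norm with the Frobenius norm, this distance is \<open>\<epsilon>(\<tau>)\<close>.
\<close>

section \<open>Hermitian matrices and the trace pairing\<close>

lemma adj_nth [simp]: "adj A $ i $ j = cnj (A $ j $ i)"
  by (simp add: adj_def)

lemma adj_adj [simp]: "adj (adj A) = A"
  by (simp add: vec_eq_iff)

lemma adj_mult: "adj (A ** B) = adj B ** adj A"
  by (simp add: vec_eq_iff matrix_matrix_mult_def mult.commute)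

lemma diag_matrix_mult_nth [simp]: "(diag d ** B) $ i $ j = of_real (d i) * B $ i $ j"
proof -
  have "(if i = k then of_real (d i) else 0) * B $ k $ j
      = (if i = k then of_real (d k) * B $ k $ j else 0)" for k
    by simp
  then show ?thesis by (simp add: matrix_matrix_mult_def diag_def)
qed

lemma matrix_mult_diag_nth [simp]: "(B ** diag d) $ i $ j = B $ i $ j * of_real (d j)"
proof -
  have "B $ i $ k * (if k = j then of_real (d k) else 0)
      = (if j = k then B $ i $ k * of_real (d k) else 0)" for k
    by simp
  then show ?thesis by (simp add: matrix_matrix_mult_def diag_def)
qed

lemma adj_diag [simp]: "adj (diag d) = diag d"
  by (simp add: vec_eq_iff diag_def)

lemma adj_mat_1 [simp]: "adj (mat 1) = mat 1"
  by (simp add: vec_eq_iff mat_def)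

lemma hermitian_0 [simp]: "hermitian 0"
  by (simp add: hermitian_def vec_eq_iff)

lemma hermitian_mat_1 [simp]: "hermitian (mat 1)"
  by (simp add: hermitian_def)

lemma hermitian_add: "hermitian A \<Longrightarrow> hermitian B \<Longrightarrow> hermitian (A + B)"
  by (simp add: hermitian_def vec_eq_iff)

lemma hermitian_diff: "hermitian A \<Longrightarrow> hermitian B \<Longrightarrow> hermitian (A - B)"
  by (simp add: hermitian_def vec_eq_iff)

lemma hermitian_scaleR: "hermitian A \<Longrightarrow> hermitian (c *\<^sub>R A)"
  by (simp add: hermitian_def vec_eq_iff)

lemma closed_hermitian: "closed {A. hermitian A}"
  unfolding hermitian_def vec_eq_iff adj_nth
  by (intro closed_Collect_all closed_Collect_eq continuous_intros)

lemma inner_eq_trace: "A \<bullet> B = Re (trace (adj A ** B))" for A B :: "complex^'n^'n"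
proof -
  have "A \<bullet> B = (\<Sum>i\<in>UNIV. \<Sum>j\<in>UNIV. Re (cnj (A $ i $ j) * B $ i $ j))"
    by (simp add: inner_vec_def inner_complex_def)
  also have "\<dots> = (\<Sum>j\<in>UNIV. \<Sum>i\<in>UNIV. Re (cnj (A $ i $ j) * B $ i $ j))"
    by (rule sum.swap)
  also have "\<dots> = Re (trace (adj A ** B))"
    by (simp add: trace_def matrix_matrix_mult_def)
  finally show ?thesis .
qed

lemma inner_hermitian: "hermitian A \<Longrightarrow> A \<bullet> B = Re (trace (A ** B))"
  by (simp add: inner_eq_trace hermitian_def)

lemma inner_mat_1: "A \<bullet> mat 1 = Re (trace A)"
  unfolding inner_commute[of A] by (simp add: inner_hermitian)

section \<open>Diagonalised matrices\<close>

definition eigen_mat :: "complex^'n^'n \<Rightarrow> ('n \<Rightarrow> real) \<Rightarrow> complex^'n^'n" where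
  "eigen_mat U d = U ** diag d ** adj U"

lemma eigen_mat_nth:
  "eigen_mat U d $ i $ j = (\<Sum>k\<in>UNIV. of_real (d k) * (U $ i $ k * cnj (U $ j $ k)))"
  unfolding eigen_mat_def matrix_matrix_mult_def[of "U ** diag d"] by (simp add: mult_ac)

lemma hermitian_eigen_mat: "hermitian (eigen_mat U d)"
  by (simp add: hermitian_def eigen_mat_def adj_mult matrix_mul_assoc)

lemma linear_eigen_mat: "linear (\<lambda>x::real^'n. eigen_mat U (\<lambda>i. x $ i))"
  by (rule linearI) (simp_all add: vec_eq_iff eigen_mat_nth distrib_right sum.distrib
      scaleR_conv_of_real[where 'a=complex] sum_distrib_left mult.assoc)

lemma unitary_adj: "unitary U \<Longrightarrow> unitary (adj U)"
  by (simp add: unitary_def)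

lemma unitary_mult: "unitary U \<Longrightarrow> unitary W \<Longrightarrow> unitary (U ** W)"
proof -
  assume U: "unitary U" and W: "unitary W"
  have "(U ** W) ** (adj W ** adj U) = U ** (W ** adj W) ** adj U"
    "(adj W ** adj U) ** (U ** W) = adj W ** (adj U ** U) ** W"
    by (simp_all add: matrix_mul_assoc)
  with U W show ?thesis by (simp add: unitary_def adj_mult)
qed

lemma diag_mult: "diag a ** diag b = diag (\<lambda>i. a i * b i)"
  by (simp add: vec_eq_iff) (simp add: diag_def)

lemma eigen_mat_mult:
  assumes "unitary U"
  shows "eigen_mat U a ** eigen_mat U b = eigen_mat U (\<lambda>i. a i * b i)"
proof -
  have "eigen_mat U a ** eigen_mat U b = U ** diag a ** (adj U ** U) ** diag b ** adj U"
    by (simp add: eigen_mat_def matrix_mul_assoc)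
  also have "\<dots> = U ** (diag a ** diag b) ** adj U"
    using assms by (simp add: unitary_def matrix_mul_assoc)
  finally show ?thesis by (simp add: diag_mult eigen_mat_def)
qed

lemma eigen_mat_const:
  assumes "unitary U"
  shows "eigen_mat U (\<lambda>_. c) = c *\<^sub>R mat 1"
proof -
  have "eigen_mat U (\<lambda>_. c) = c *\<^sub>R (U ** adj U)"
    by (simp add: vec_eq_iff eigen_mat_nth matrix_matrix_mult_def sum_distrib_left
        scaleR_conv_of_real[where 'a=complex])
  with assms show ?thesis by (simp add: unitary_def)
qed

lemma trace_eigen_mat:
  assumes "unitary U"
  shows "trace (eigen_mat U d) = of_real (\<Sum>i\<in>UNIV. d i)"
proof -
  have "trace (eigen_mat U d) = trace (adj U ** (U ** diag d))"
    unfolding eigen_mat_def by (rule trace_mul_sym)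
  also have "\<dots> = trace (diag d)"
    using assms by (simp add: matrix_mul_assoc unitary_def)
  also have "\<dots> = of_real (\<Sum>i\<in>UNIV. d i)"
    by (simp add: trace_def diag_def)
  finally show ?thesis .
qed

text \<open>
  The squared moduli \<open>|\<langle>u\<^sub>i, w\<^sub>j\<rangle>|\<^sup>2\<close> between the columns of two unitary matrices. They form a doubly
  stochastic matrix, which is how trace inequalities for two non-commuting Hermitian matrices reduce
  to scalar inequalities between their eigenvalues.
\<close>

definition overlap :: "complex^'n^'n \<Rightarrow> complex^'n^'n \<Rightarrow> 'n \<Rightarrow> 'n \<Rightarrow> real" where
  "overlap U W i j = (cmod ((adj U ** W) $ i $ j))\<^sup>2"

lemma overlap_nonneg: "overlap U W i j \<ge> 0"
  by (simp add: overlap_def)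

lemma inner_eigen_mat:
  "eigen_mat U a \<bullet> eigen_mat W b = (\<Sum>i\<in>UNIV. \<Sum>j\<in>UNIV. overlap U W i j * (a i * b j))"
proof -
  let ?T = "adj U ** W"
  have "eigen_mat U a \<bullet> eigen_mat W b = Re (trace (U ** (diag a ** (adj U ** eigen_mat W b))))"
    by (simp add: inner_hermitian hermitian_eigen_mat) (simp add: eigen_mat_def matrix_mul_assoc)
  also have "\<dots> = Re (trace ((diag a ** (adj U ** eigen_mat W b)) ** U))"
    by (subst trace_mul_sym) simp
  also have "(diag a ** (adj U ** eigen_mat W b)) ** U = diag a ** eigen_mat ?T b"
    by (simp add: eigen_mat_def adj_mult matrix_mul_assoc)
  also have "Re (trace \<dots>) = (\<Sum>i\<in>UNIV. a i * Re (eigen_mat ?T b $ i $ i))"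
    by (simp add: trace_def)
  also have "\<dots> = (\<Sum>i\<in>UNIV. \<Sum>j\<in>UNIV. overlap U W i j * (a i * b j))"
    unfolding eigen_mat_nth complex_norm_square[symmetric] overlap_def
    by (simp add: sum_distrib_left mult_ac)
  finally show ?thesis .
qed

lemma overlap_row_sum:
  assumes "unitary U" "unitary W"
  shows "(\<Sum>j\<in>UNIV. overlap U W i j) = 1"
proof -
  have T: "unitary (adj U ** W)"
    using assms by (simp add: unitary_adj unitary_mult)
  have "of_real (\<Sum>j\<in>UNIV. overlap U W i j) = ((adj U ** W) ** adj (adj U ** W)) $ i $ i"
    unfolding matrix_matrix_mult_def[of "adj U ** W"]
    by (simp add: overlap_def complex_norm_square del: of_real_power)
  also have "\<dots> = 1"
    using T by (simp add: unitary_def mat_def)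
  finally show ?thesis by (metis of_real_eq_1_iff)
qed

lemma overlap_commute: "overlap U W i j = overlap W U j i"
proof -
  have "(adj U ** W) $ i $ j = cnj ((adj W ** U) $ j $ i)"
    using adj_mult[of "adj W" U] adj_nth[of "adj W ** U" i j] by simp
  then show ?thesis by (simp add: overlap_def)
qed

lemma overlap_column_sum:
  assumes "unitary U" "unitary W"
  shows "(\<Sum>i\<in>UNIV. overlap U W i j) = 1"
  using overlap_row_sum[OF assms(2,1), of j] by (simp add: overlap_commute[of U])

lemma sum_overlap_row:
  assumes "unitary U" "unitary W"
  shows "(\<Sum>i\<in>UNIV. \<Sum>j\<in>UNIV. overlap U W i j * g i) = (\<Sum>i\<in>UNIV. g i)"
  by (simp add: sum_distrib_right[symmetric] overlap_row_sum[OF assms])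

lemma sum_overlap_column:
  assumes "unitary U" "unitary W"
  shows "(\<Sum>i\<in>UNIV. \<Sum>j\<in>UNIV. overlap U W i j * g j) = (\<Sum>j\<in>UNIV. g j)"
  by (subst sum.swap) (simp add: sum_distrib_right[symmetric] overlap_column_sum[OF assms])

section \<open>The spectral theorem\<close>

definition cinner :: "complex^'n \<Rightarrow> complex^'n \<Rightarrow> complex" where
  "cinner v w = (\<Sum>i\<in>UNIV. cnj (v $ i) * w $ i)"

lemma Re_cinner: "Re (cinner v w) = v \<bullet> w"
  by (simp add: cinner_def inner_vec_def inner_complex_def)

lemma Im_cinner: "Im (cinner v w) = (\<i> *s v) \<bullet> w"
  by (simp add: cinner_def inner_vec_def inner_complex_def algebra_simps)

lemma cinner_self: "cinner v v = of_real ((norm v)\<^sup>2)"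
proof (rule complex_eqI)
  show "Re (cinner v v) = Re (of_real ((norm v)\<^sup>2))"
    by (simp add: Re_cinner power2_norm_eq_inner)
  show "Im (cinner v v) = Im (of_real ((norm v)\<^sup>2))"
    by (simp add: cinner_def mult.commute)
qed

lemma cinner_commute: "cinner v w = cnj (cinner w v)"
  by (simp add: cinner_def mult.commute)

lemma cinner_scaleR_left: "cinner (c *\<^sub>R v) w = c *\<^sub>R cinner v w"
  by (simp add: cinner_def scaleR_sum_right)

lemma cinner_adj: "cinner (A *v v) w = cinner v (adj A *v w)"
proof -
  have "cinner (A *v v) w = (\<Sum>i\<in>UNIV. \<Sum>j\<in>UNIV. cnj (A$i$j) * cnj (v$j) * w $ i)"
    by (simp add: cinner_def matrix_vector_mult_def sum_distrib_right)
  also have "\<dots> = (\<Sum>j\<in>UNIV. \<Sum>i\<in>UNIV. cnj (A$i$j) * cnj (v$j) * w $ i)"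
    by (rule sum.swap)
  also have "\<dots> = cinner v (adj A *v w)"
    by (simp add: cinner_def matrix_vector_mult_def sum_distrib_left mult_ac)
  finally show ?thesis .
qed

text \<open>
  The Rayleigh quotient attains its maximum over the unit vectors orthogonal to the given
  eigenvectors, because these form a compact set; it is nonempty for dimension reasons. The
  orthogonal complement is invariant under \<open>A\<close>, so the first-order condition at a maximiser can be
  tested against \<open>A v - q(v) v\<close> itself, which forces this vector to vanish.
\<close>

lemma eigenvector_in_complement:
  fixes A :: "complex^'n^'n" and u :: "'n \<Rightarrow> complex^'n"
  assumes A: "hermitian A" and I: "I \<noteq> UNIV"
    and eig: "\<And>i. i \<in> I \<Longrightarrow> A *v u i = d i *\<^sub>R u i"
  shows "\<exists>v c. norm v = 1 \<and> A *v v = c *\<^sub>R v \<and> (\<forall>i\<in>I. cinner (u i) v = 0)"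
proof -
  define W where "W = {v. \<forall>i\<in>I. cinner (u i) v = 0}"
  define q where "q v = v \<bullet> (A *v v)" for v :: "complex^'n"
  have sym: "(A *v v) \<bullet> w = v \<bullet> (A *v w)" for v w
    using arg_cong[OF cinner_adj[of A v w], of Re] A by (simp add: Re_cinner hermitian_def)
  have lin: "linear ((*v) A)"
    by (simp add: linear_iff matrix_vector_mult_def vec_eq_iff
        scaleR_sum_right distrib_left sum.distrib)
  have cW: "closed W"
  proof -
    have "closed {v. cinner (u i) v = 0}" for i
      unfolding cinner_def by (intro closed_Collect_eq continuous_intros)
    moreover have "W = (\<Inter>i\<in>I. {v. cinner (u i) v = 0})"
      by (auto simp: W_def)
    ultimately show ?thesis by auto
  qed
  have subW: "x \<in> W \<Longrightarrow> y \<in> W \<Longrightarrow> x + y \<in> W" "x \<in> W \<Longrightarrow> c *\<^sub>R x \<in> W" for x y c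
    by (auto simp: W_def cinner_def algebra_simps sum.distrib scaleR_sum_right[symmetric])
  have AW: "A *v x \<in> W" if "x \<in> W" for x
  proof -
    have "cinner (u i) (A *v x) = 0" if i: "i \<in> I" for i
      using cinner_adj[of A "u i" x] A eig[OF i] i \<open>x \<in> W\<close>
      by (simp add: hermitian_def cinner_scaleR_left W_def)
    then show ?thesis by (simp add: W_def)
  qed
  \<comment> \<open>Real orthogonality to both \<open>u i\<close> and \<open>\<i> u i\<close> is complex orthogonality to \<open>u i\<close>, so at most
    \<open>2 |I|\<close> of the \<open>2 CARD('n)\<close> real dimensions are excluded.\<close>
  have "card I < CARD('n)"
    using I by (metis psubset_card_mono finite top.not_eq_extremum)
  moreover have "dim (u ` I \<union> (\<lambda>i. \<i> *s u i) ` I) \<le> card I + card I"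
    by (intro order_trans[OF dim_le_card'] order_trans[OF card_Un_le] add_mono card_image_le) auto
  ultimately have "dim (u ` I \<union> (\<lambda>i. \<i> *s u i) ` I) < DIM(complex^'n)"
    by simp
  then obtain x where x: "x \<noteq> 0" "\<And>y. y \<in> span (u ` I \<union> (\<lambda>i. \<i> *s u i) ` I) \<Longrightarrow> orthogonal x y"
    by (rule orthogonal_to_subspace_exists) blast
  have "x \<in> W"
    unfolding W_def
  proof (intro CollectI ballI complex_eqI)
    fix i assume i: "i \<in> I"
    show "Re (cinner (u i) x) = Re 0"
      using x(2)[OF span_base, of "u i"] i by (simp add: Re_cinner orthogonal_def inner_commute)
    show "Im (cinner (u i) x) = Im 0"
      using x(2)[OF span_base, of "\<i> *s u i"] i by (simp add: Im_cinner orthogonal_def inner_commute)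
  qed
  then have ne: "(1 / norm x) *\<^sub>R x \<in> W \<inter> sphere 0 1"
    using x(1) subW(2) by simp
  have comp: "compact (W \<inter> sphere 0 1)"
    by (simp add: cW closed_Int_compact)
  have "continuous_on (W \<inter> sphere 0 1) q"
    unfolding q_def by (intro continuous_intros linear_continuous_on_compose lin) 
  then obtain v where v: "v \<in> W" "norm v = 1" and vmax: "\<And>y. y \<in> W \<Longrightarrow> norm y = 1 \<Longrightarrow> q y \<le> q v"
    using continuous_attains_sup[OF comp] ne by (metis (no_types, lifting) Int_iff empty_iff mem_sphere_0)
  have hom: "q (c *\<^sub>R y) = c\<^sup>2 * q y" for c y
    by (simp add: q_def linear_cmul[OF lin] power2_eq_square)
  have vmax': "q y \<le> q v * (y \<bullet> y)" if "y \<in> W" for y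
  proof (cases "y = 0")
    case False
    then have "q ((1 / norm y) *\<^sub>R y) \<le> q v"
      by (intro vmax subW that) simp
    then show ?thesis
      using False by (simp add: hom power_divide field_simps power2_norm_eq_inner)
  qed (simp add: q_def)
  define w where "w = A *v v - q v *\<^sub>R v"
  have wW: "w \<in> W"
    unfolding w_def using subW(1)[OF AW[OF v(1)] subW(2)[OF v(1), of "- q v"]] by simp
  have vv: "v \<bullet> v = 1"
    using v(2) by (simp add: norm_eq_sqrt_inner)
  have vw: "v \<bullet> w = 0"
    by (simp add: w_def inner_diff_right q_def vv)
  have wAv: "w \<bullet> (A *v v) = w \<bullet> w"
    using vw by (simp add: w_def inner_diff_right inner_commute)
  \<comment> \<open>Maximality along the curve \<open>v + t w\<close>: the term linear in \<open>t\<close> cannot be dominated by the quadratic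
    one for small \<open>t > 0\<close> unless \<open>w = 0\<close>.\<close>
  have le: "2 * t * (w \<bullet> w) \<le> t\<^sup>2 * (q v * (w \<bullet> w) - q w)" for t
  proof -
    have "q (v + t *\<^sub>R w) = q v + 2 * t * (w \<bullet> (A *v v)) + t\<^sup>2 * q w"
      using sym[of v w]
      by (simp add: q_def linear_add[OF lin] linear_cmul[OF lin] algebra_simps power2_eq_square
          inner_commute)
    moreover have "(v + t *\<^sub>R w) \<bullet> (v + t *\<^sub>R w) = 1 + t\<^sup>2 * (w \<bullet> w)"
      using vw vv by (simp add: algebra_simps power2_eq_square inner_commute)
    ultimately show ?thesis
      using vmax'[OF subW(1)[OF v(1) subW(2)[OF wW, of t]]] wAv by (simp add: algebra_simps)
  qed
  have "w \<bullet> w \<le> 0"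
  proof (rule field_le_epsilon)
    fix e :: real assume e: "e > 0"
    define K where "K = \<bar>q v * (w \<bullet> w) - q w\<bar> + 1"
    have K: "K > 0" by (simp add: K_def)
    have "2 * (e / K) * (w \<bullet> w) \<le> (e / K)\<^sup>2 * (q v * (w \<bullet> w) - q w)"
      by (rule le)
    also have "\<dots> \<le> (e / K)\<^sup>2 * K"
      by (intro mult_left_mono) (auto simp: K_def)
    finally have "2 * (w \<bullet> w) \<le> e"
      using e K by (simp add: field_simps power2_eq_square)
    then show "w \<bullet> w \<le> 0 + e" using e inner_ge_zero[of w] by linarith
  qed
  then have "w = 0" using inner_ge_zero[of w] by (metis inner_eq_zero_iff order_antisym)
  then have "A *v v = q v *\<^sub>R v" by (simp add: w_def)
  with v show ?thesis by (auto simp: W_def)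
qed

text \<open>
  Induction over sets of matrix indices makes the orthonormal eigenvectors come out already indexed
  by \<open>'n\<close>, hence as the columns of a square matrix.
\<close>

theorem hermitian_spectral:
  fixes A :: "complex^'n^'n"
  assumes "hermitian A"
  obtains U d where "unitary U" "A = eigen_mat U d"
proof -
  have "\<exists>(u :: 'n \<Rightarrow> complex^'n) d. (\<forall>i\<in>I. A *v u i = d i *\<^sub>R u i) \<and>
      (\<forall>i\<in>I. \<forall>j\<in>I. cinner (u i) (u j) = (if i = j then 1 else 0))" for I :: "'n set"
  proof (induction I rule: finite_induct[OF finite])
    case 1
    then show ?case by simp
  next
    case (2 i I)
    then obtain u d where ud: "\<And>i. i \<in> I \<Longrightarrow> A *v u i = d i *\<^sub>R u i"
      "\<And>i j. i \<in> I \<Longrightarrow> j \<in> I \<Longrightarrow> cinner (u i) (u j) = (if i = j then 1 else 0)" by blast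
    from 2 have "I \<noteq> UNIV" by auto
    from eigenvector_in_complement[of A I u d, OF assms this ud(1)]
    obtain v c where v: "norm v = 1" "A *v v = c *\<^sub>R v" "\<And>j. j \<in> I \<Longrightarrow> cinner (u j) v = 0"
      by blast
    have "cinner v (u j) = 0" if "j \<in> I" for j
      using v(3)[OF that] cinner_commute[of v "u j"] by simp
    moreover have "cinner v v = 1" using v(1) by (simp add: cinner_self)
    ultimately show ?case
      using 2 ud v by (intro exI[of _ "u(i := v)"] exI[of _ "d(i := c)"]) auto
  qed
  from this[of UNIV] obtain u :: "'n \<Rightarrow> complex^'n" and d where eig: "\<And>i. A *v u i = d i *\<^sub>R u i"
    and on: "\<And>i j. cinner (u i) (u j) = (if i = j then 1 else 0)" by auto
  define U :: "complex^'n^'n" where "U = (\<chi> i k. u k $ i)"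
  have "adj U ** U = mat 1"
    using on by (simp add: vec_eq_iff U_def matrix_matrix_mult_def mat_def cinner_def)
  then have U: "unitary U"
    by (simp add: unitary_def matrix_left_right_inverse)
  have "(A ** U) $ i $ k = (U ** diag d) $ i $ k" for i k
  proof -
    have "(A ** U) $ i $ k = (A *v u k) $ i"
      by (simp add: U_def matrix_matrix_mult_def matrix_vector_mult_def)
    also have "\<dots> = (U ** diag d) $ i $ k"
      unfolding eig
      by (simp add: U_def scaleR_conv_of_real[where 'a=complex] mult.commute)
    finally show ?thesis .
  qed
  then have "A ** U = U ** diag d" by (simp add: vec_eq_iff)
  then have "A ** (U ** adj U) = eigen_mat U d"
    by (simp add: eigen_mat_def matrix_mul_assoc)
  with U have "A = eigen_mat U d" by (simp add: unitary_def)
  with U that show thesis by blast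
qed

section \<open>Functional calculus\<close>

lemma eigen_mat_scaleR: "c *\<^sub>R eigen_mat U d = eigen_mat U (\<lambda>i. c * d i)"
  by (simp add: vec_eq_iff eigen_mat_nth scaleR_conv_of_real[where 'a=complex] sum_distrib_left
      mult.assoc)

lemma eigen_mat_diff: "eigen_mat U a - eigen_mat U b = eigen_mat U (\<lambda>i. a i - b i)"
  by (simp add: vec_eq_iff eigen_mat_nth left_diff_distrib sum_subtractf)

text \<open>
  If \<open>U diag(d) U\<^sup>* = W diag(e) W\<^sup>*\<close>, then \<open>T = U\<^sup>* W\<close> intertwines \<open>diag d\<close> and \<open>diag e\<close>, so that \<open>T\<close>
  is supported on the pairs with \<open>d\<^sub>i = e\<^sub>j\<close>. It therefore also intertwines their images under any
  \<open>\<phi>\<close>: the functional calculus does not depend on the diagonalisation.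
\<close>

lemma eigen_mat_comp_cong:
  assumes "unitary U" "unitary W" and eq: "eigen_mat U d = eigen_mat W e"
  shows "eigen_mat U (\<phi> \<circ> d) = eigen_mat W (\<phi> \<circ> e)"
proof -
  let ?T = "adj U ** W"
  have rot: "adj U ** eigen_mat U g ** W = diag g ** ?T" "adj U ** eigen_mat W g ** W = ?T ** diag g" for g
  proof -
    have "adj U ** eigen_mat U g ** W = (adj U ** U) ** diag g ** ?T"
      "adj U ** eigen_mat W g ** W = ?T ** diag g ** (adj W ** W)"
      by (simp_all add: eigen_mat_def matrix_mul_assoc)
    then show "adj U ** eigen_mat U g ** W = diag g ** ?T"
      "adj U ** eigen_mat W g ** W = ?T ** diag g"
      using assms by (simp_all add: unitary_def)
  qed
  have "diag d ** ?T = ?T ** diag e"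
    unfolding rot[symmetric] eq ..
  then have "of_real (d i) * ?T $ i $ j = ?T $ i $ j * of_real (e j)" for i j
    by (metis diag_matrix_mult_nth matrix_mult_diag_nth)
  then have "d i = e j \<or> ?T $ i $ j = 0" for i j
    by (metis mult.commute mult_cancel_left of_real_eq_iff)
  then have "diag (\<phi> \<circ> d) ** ?T = ?T ** diag (\<phi> \<circ> e)"
    by (simp add: vec_eq_iff) metis
  then have "adj U ** eigen_mat U (\<phi> \<circ> d) ** W = adj U ** eigen_mat W (\<phi> \<circ> e) ** W"
    by (simp add: rot)
  then have "(U ** adj U) ** eigen_mat U (\<phi> \<circ> d) ** (W ** adj W)
      = (U ** adj U) ** eigen_mat W (\<phi> \<circ> e) ** (W ** adj W)"
    by (metis matrix_mul_assoc)
  with assms show ?thesis by (simp add: unitary_def)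
qed

lemma spectral_fun_eigen_mat:
  assumes "unitary U"
  shows "spectral_fun \<phi> (eigen_mat U d) = eigen_mat U (\<phi> \<circ> d)"
  unfolding spectral_fun_def eigen_mat_def[symmetric]
proof (rule the_equality)
  show "\<exists>W e. unitary W \<and> eigen_mat U d = eigen_mat W e \<and> eigen_mat U (\<phi> \<circ> d) = eigen_mat W (\<phi> \<circ> e)"
    using assms by (intro exI[of _ U] exI[of _ d]) simp
next
  fix B assume "\<exists>W e. unitary W \<and> eigen_mat U d = eigen_mat W e \<and> B = eigen_mat W (\<phi> \<circ> e)"
  then obtain W e where "unitary W" "eigen_mat U d = eigen_mat W e" "B = eigen_mat W (\<phi> \<circ> e)"
    by (elim exE conjE)
  with eigen_mat_comp_cong[OF assms, of W d e \<phi>] show "B = eigen_mat U (\<phi> \<circ> d)" by simp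
qed

lemma mlog_eigen_mat: "unitary U \<Longrightarrow> mlog (eigen_mat U d) = eigen_mat U (\<lambda>i. ln (d i))"
  by (simp add: mlog_def spectral_fun_eigen_mat comp_def)

lemma mexp_eigen_mat:
  assumes "unitary U"
  shows "mexp (eigen_mat U d) = eigen_mat U (\<lambda>i. exp (d i))"
proof -
  have pow: "((**) (eigen_mat U d) ^^ k) (mat 1) = eigen_mat U (\<lambda>i. d i ^ k)" for k
  proof (induction k)
    case 0
    then show ?case using eigen_mat_const[OF assms, of 1] by simp
  next
    case (Suc k)
    then show ?case by (simp add: eigen_mat_mult[OF assms])
  qed
  have "(\<lambda>k. (1 / fact k) *\<^sub>R (\<chi> i. d i ^ k)) sums (\<chi> i. exp (d i))"
    unfolding sums_def
  proof (rule vec_tendstoI)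
    fix i
    have "(\<lambda>n. \<Sum>k<n. d i ^ k /\<^sub>R fact k) \<longlonglongrightarrow> exp (d i)"
      using exp_converges[of "d i"] by (simp add: sums_def)
    then show "(\<lambda>n. (\<Sum>k<n. (1 / fact k) *\<^sub>R (\<chi> i. d i ^ k)) $ i) \<longlonglongrightarrow> (\<chi> i. exp (d i)) $ i"
      by (simp add: divide_inverse)
  qed
  from bounded_linear.sums[OF linear_conv_bounded_linear[THEN iffD1, OF linear_eigen_mat[of U]] this]
  have "(\<lambda>k. (1 / fact k) *\<^sub>R eigen_mat U (\<lambda>i. d i ^ k)) sums eigen_mat U (\<lambda>i. exp (d i))"
    by (simp add: eigen_mat_scaleR)
  then show ?thesis
    unfolding mexp_def pow by (rule sums_unique[symmetric])
qed

lemma inner_eigen_mat_same: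
  assumes "unitary U"
  shows "eigen_mat U a \<bullet> eigen_mat U b = (\<Sum>i\<in>UNIV. a i * b i)"
  by (simp add: inner_hermitian hermitian_eigen_mat eigen_mat_mult trace_eigen_mat assms)

section \<open>The spectrahedron\<close>

lemma diag_vector_mult_nth [simp]: "(diag d *v w) $ i = of_real (d i) * w $ i"
proof -
  have "(if i = k then of_real (d i) else 0) * w $ k
      = (if i = k then of_real (d k) * w $ k else 0)" for k
    by simp
  then show ?thesis by (simp add: matrix_vector_mult_def diag_def)
qed

lemma quadratic_form_eigen_mat:
  "Re (cinner v (eigen_mat U d *v v)) = (\<Sum>k\<in>UNIV. d k * (cmod ((adj U *v v) $ k))\<^sup>2)"
proof -
  let ?w = "adj U *v v"
  have "cinner v (eigen_mat U d *v v) = cinner v (U *v (diag d *v ?w))"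
    by (simp add: eigen_mat_def matrix_vector_mul_assoc matrix_mul_assoc)
  also have "\<dots> = cinner ?w (diag d *v ?w)"
    by (simp add: cinner_adj)
  also have "\<dots> = (\<Sum>k\<in>UNIV. of_real (d k * (cmod (?w $ k))\<^sup>2))"
    by (simp add: cinner_def complex_norm_square mult_ac del: of_real_power)
  finally show ?thesis by simp
qed

lemma psd_altdef: "psd A \<longleftrightarrow> hermitian A \<and> (\<forall>v. 0 \<le> Re (cinner v (A *v v)))"
  by (simp add: psd_def cinner_def)

lemma spectrahedron_hermitian: "X \<in> spectrahedron \<Longrightarrow> hermitian X"
  by (simp add: spectrahedron_def psd_def)

lemma spectrahedron_inner_mat_1: "X \<in> spectrahedron \<Longrightarrow> X \<bullet> mat 1 = 1"
  by (simp add: inner_mat_1 spectrahedron_def)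

lemma eigen_mat_in_spectrahedron:
  assumes "unitary U" "\<And>i. d i \<ge> 0" "(\<Sum>i\<in>UNIV. d i) = 1"
  shows "eigen_mat U d \<in> spectrahedron"
  unfolding spectrahedron_def psd_altdef mem_Collect_eq quadratic_form_eigen_mat
  using assms by (auto simp: hermitian_eigen_mat trace_eigen_mat intro!: sum_nonneg
    simp del: of_real_sum)

lemma spectrahedron_eigen_matE:
  assumes "X \<in> spectrahedron"
  obtains U d where "unitary U" "X = eigen_mat U d" "\<And>i. 0 \<le> d i" "\<And>i. d i \<le> 1" "(\<Sum>i\<in>UNIV. d i) = 1"
proof -
  obtain U d where U: "unitary U" and X: "X = eigen_mat U d"
    using hermitian_spectral spectrahedron_hermitian[OF assms] by blast
  have nonneg: "0 \<le> d k" for k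
  proof -
    have "adj U *v (U *v axis k 1) = axis k 1"
      using U by (simp add: unitary_def matrix_vector_mul_assoc)
    then have "Re (cinner (U *v axis k 1) (X *v (U *v axis k 1))) = (\<Sum>i\<in>UNIV. if i = k then d i else 0)"
      unfolding X quadratic_form_eigen_mat by (intro sum.cong) (auto simp: axis_def)
    then show ?thesis
      using assms by (simp add: spectrahedron_def psd_altdef) (metis)
  qed
  have sum1: "(\<Sum>i\<in>UNIV. d i) = 1"
    using assms trace_eigen_mat[OF U, of d] unfolding X spectrahedron_def
    by (metis (mono_tags, lifting) mem_Collect_eq of_real_eq_1_iff)
  have "d k \<le> 1" for k
    using member_le_sum[of k UNIV d] nonneg sum1 by simp
  with that U X nonneg sum1 show thesis by blast
qed

lemma convex_spectrahedron: "convex (spectrahedron :: (complex^'n^'n) set)"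
proof (rule convexI)
  fix X Y :: "complex^'n^'n" and u v :: real
  assume X: "X \<in> spectrahedron" and Y: "Y \<in> spectrahedron" and uv: "0 \<le> u" "0 \<le> v" "u + v = 1"
  have "cinner w ((u *\<^sub>R X + v *\<^sub>R Y) *v w) = u *\<^sub>R cinner w (X *v w) + v *\<^sub>R cinner w (Y *v w)" for w
    by (simp add: cinner_def matrix_vector_mult_def scaleR_sum_right sum.distrib distrib_left distrib_right
        sum_distrib_left)
  moreover have "trace (u *\<^sub>R X + v *\<^sub>R Y) = u *\<^sub>R trace X + v *\<^sub>R trace Y"
    by (simp add: trace_def sum.distrib scaleR_sum_right)
  ultimately show "u *\<^sub>R X + v *\<^sub>R Y \<in> spectrahedron"
    using X Y uv unfolding spectrahedron_def psd_altdef
    by (auto simp: hermitian_add hermitian_scaleR scaleR_add_left[symmetric] simp flip: of_real_add)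
qed

lemma compact_spectrahedron: "compact (spectrahedron :: (complex^'n^'n) set)"
proof -
  have "closed ({X. hermitian X} \<inter> (\<Inter>v. {X. 0 \<le> Re (cinner v (X *v v))})
      \<inter> {X::complex^'n^'n. trace X = 1})"
    unfolding cinner_def matrix_vector_mult_def vec_lambda_beta trace_def
    by (intro closed_Int closed_INT ballI closed_hermitian closed_Collect_le closed_Collect_eq
        continuous_intros)
  also have "{X. hermitian X} \<inter> (\<Inter>v. {X. 0 \<le> Re (cinner v (X *v v))}) \<inter> {X. trace X = 1}
      = (spectrahedron :: (complex^'n^'n) set)"
    by (auto simp: spectrahedron_def psd_altdef)
  finally have "closed (spectrahedron :: (complex^'n^'n) set)" .
  moreover have "norm X \<le> 1" if "X \<in> spectrahedron" for X :: "complex^'n^'n"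
  proof -
    obtain U d where X: "unitary U" "X = eigen_mat U d" and d: "\<And>i. 0 \<le> d i" "\<And>i. d i \<le> 1" "(\<Sum>i\<in>UNIV. d i) = 1"
      using spectrahedron_eigen_matE[OF \<open>X \<in> spectrahedron\<close>] by blast
    have "X \<bullet> X = (\<Sum>i\<in>UNIV. d i * d i)"
      by (simp add: X inner_eigen_mat_same)
    also have "\<dots> \<le> (\<Sum>i\<in>UNIV. d i)"
      using d by (intro sum_mono) (simp add: mult_left_le)
    finally show ?thesis using d(3) by (simp add: norm_eq_sqrt_inner)
  qed
  ultimately show ?thesis
    by (metis bounded_iff compact_eq_bounded_closed)
qed

section \<open>The Gibbs map\<close>

definition log_partition :: "complex^'n^'n \<Rightarrow> real" where
  "log_partition Y = ln (Re (trace (mexp Y)))"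

lemma gibbs_eigen_mat:
  assumes "unitary U"
  shows "gibbs (eigen_mat U y) = eigen_mat U (\<lambda>i. exp (y i) / (\<Sum>k\<in>UNIV. exp (y k)))"
    and "log_partition (eigen_mat U y) = ln (\<Sum>k\<in>UNIV. exp (y k))"
  by (simp_all add: gibbs_def log_partition_def mexp_eigen_mat trace_eigen_mat assms eigen_mat_scaleR
      del: of_real_sum)

lemma sum_exp_pos: "0 < (\<Sum>k\<in>UNIV. exp (y k :: real))" for y :: "'n::finite \<Rightarrow> real"
  by (intro sum_pos) auto

lemma gibbs_eigen_matE:
  assumes "hermitian Y"
  obtains U b where "unitary U" "gibbs Y = eigen_mat U b" "\<And>i. 0 < b i" "\<And>i. b i \<le> 1" "(\<Sum>i\<in>UNIV. b i) = 1"
proof -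
  obtain U y where U: "unitary U" and Y: "Y = eigen_mat U y"
    using hermitian_spectral assms by blast
  let ?b = "\<lambda>i. exp (y i) / (\<Sum>k\<in>UNIV. exp (y k))"
  have pos: "0 < ?b i" for i
    using sum_exp_pos[of y] by simp
  have sum1: "(\<Sum>i\<in>UNIV. ?b i) = 1"
    using sum_exp_pos[of y] by (simp add: sum_divide_distrib[symmetric])
  have "?b i \<le> 1" for i
    using member_le_sum[of i UNIV ?b] pos sum1 by (simp add: less_imp_le)
  with that U pos sum1 show thesis by (metis Y gibbs_eigen_mat(1))
qed

lemma gibbs_in_spectrahedron:
  assumes "hermitian Y"
  shows "gibbs Y \<in> spectrahedron"
  by (rule gibbs_eigen_matE[OF assms]) (simp add: eigen_mat_in_spectrahedron less_imp_le)

text \<open>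
  The Gibbs map forgets exactly the multiple of the identity in \<open>Y\<close>. Against differences of
  matrices of trace one this multiple is invisible, so \<open>Y\<close> may be traded for \<open>log X\<close>.
\<close>

lemma mlog_gibbs:
  assumes "hermitian Y"
  shows "mlog (gibbs Y) = Y - log_partition Y *\<^sub>R mat 1"
proof -
  obtain U y where U: "unitary U" and Y: "Y = eigen_mat U y"
    using hermitian_spectral assms by blast
  show ?thesis
    using sum_exp_pos[of y] unfolding eigen_mat_const[OF U, symmetric]
    by (simp add: Y U gibbs_eigen_mat mlog_eigen_mat eigen_mat_diff ln_div)
qed

section \<open>Quantum relative entropy\<close>

lemma neg_entropy_inner: "hermitian X \<Longrightarrow> neg_entropy X = X \<bullet> mlog X"
  by (simp add: neg_entropy_def inner_hermitian)

text \<open>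
  Umegaki's quantum relative entropy of \<open>A\<close> with respect to \<open>B\<close>.
\<close>

definition rel_entropy :: "complex^'n^'n \<Rightarrow> complex^'n^'n \<Rightarrow> real" where
  "rel_entropy A B = A \<bullet> (mlog A - mlog B)"

lemma rel_entropy_self [simp]: "rel_entropy A A = 0"
  by (simp add: rel_entropy_def)

text \<open>
  The Bregman divergence of \<open>x ln x\<close> dominates that of \<open>x\<^sup>2 / 2\<close> on the unit interval, where the
  second derivative \<open>1 / x\<close> is at least \<open>1\<close>. The difference \<open>g\<close> of the two vanishes at \<open>b\<close>, and its
  derivative changes sign there since \<open>ln x - x\<close> is increasing.
\<close>

lemma scalar_bregman:
  fixes a b :: real
  assumes "0 \<le> a" "a \<le> 1" "0 < b" "b \<le> 1"
  shows "(a - b)\<^sup>2 / 2 \<le> a * ln a - a * ln b - a + b"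
proof (cases "a = 0")
  case True
  have "b\<^sup>2 \<le> b" using assms by (simp add: power2_eq_square mult_left_le)
  with True assms show ?thesis by simp
next
  case False
  define g where "g x = x * ln x - x * ln b - x + b - (x - b)\<^sup>2 / 2" for x
  have deriv: "(g has_real_derivative (ln x - x) - (ln b - b)) (at x)" if "x > 0" for x
    unfolding g_def using that by (auto intro!: derivative_eq_intros simp: field_simps)
  have mono: "ln x - x \<le> ln y - y" if "0 < x" "x \<le> y" "y \<le> 1" for x y :: real
  proof -
    have "ln y - ln x = - ln (x / y)" using that by (simp add: ln_div)
    moreover have "ln (x / y) \<le> x / y - 1" using that by (intro ln_le_minus_one) simp
    moreover have "y - x \<le> 1 - x / y"
      using that mult_right_mono[of y 1 "y - x"] by (simp add: field_simps)
    ultimately show ?thesis by linarith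
  qed
  have "g b \<le> g a"
  proof (cases "a \<le> b")
    case True
    show ?thesis
    proof (rule DERIV_nonpos_imp_nonincreasing[OF True])
      fix x assume "a \<le> x" "x \<le> b"
      then show "\<exists>y. (g has_real_derivative y) (at x) \<and> y \<le> 0"
        using deriv[of x] mono[of x b] False assms by force
    qed
  next
    case ge: False
    then have "b \<le> a" by simp
    then show ?thesis
    proof (rule DERIV_nonneg_imp_nondecreasing)
      fix x assume "b \<le> x" "x \<le> a"
      then show "\<exists>y. (g has_real_derivative y) (at x) \<and> y \<ge> 0"
        using deriv[of x] mono[of b x] assms by force
    qed
  qed
  then show ?thesis by (simp add: g_def)
qed

text \<open>
  A quantitative Klein inequality. In the two eigenbases both sides are averages, with the doubly
  stochastic weights \<^const>\<open>overlap\<close>, of the two sides of the scalar inequality above; the trace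
  condition supplies the terms \<open>- a + b\<close> for free.
\<close>

lemma rel_entropy_gibbs_lower_bound:
  assumes A: "A \<in> spectrahedron" and Y: "hermitian Y"
  shows "(norm (A - gibbs Y))\<^sup>2 / 2 \<le> rel_entropy A (gibbs Y)"
proof -
  obtain U a where U: "unitary U" "A = eigen_mat U a" and a: "\<And>i. 0 \<le> a i" "\<And>i. a i \<le> 1" "(\<Sum>i\<in>UNIV. a i) = 1"
    using spectrahedron_eigen_matE[OF A] by blast
  obtain W b where W: "unitary W" "gibbs Y = eigen_mat W b" and b: "\<And>i. 0 < b i" "\<And>i. b i \<le> 1" "(\<Sum>i\<in>UNIV. b i) = 1"
    using gibbs_eigen_matE[OF Y] by blast
  let ?S = "overlap U W"
  have row: "(\<Sum>i\<in>UNIV. \<Sum>j\<in>UNIV. ?S i j * g i) = (\<Sum>i\<in>UNIV. g i)" for g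
    by (rule sum_overlap_row[OF U(1) W(1)])
  have col: "(\<Sum>i\<in>UNIV. \<Sum>j\<in>UNIV. ?S i j * g j) = (\<Sum>j\<in>UNIV. g j)" for g
    by (rule sum_overlap_column[OF U(1) W(1)])
  have "(norm (A - gibbs Y))\<^sup>2 = A \<bullet> A - 2 * (A \<bullet> gibbs Y) + gibbs Y \<bullet> gibbs Y"
    by (simp add: power2_norm_eq_inner algebra_simps inner_commute)
  also have "\<dots> = (\<Sum>i\<in>UNIV. \<Sum>j\<in>UNIV. ?S i j * (a i - b j)\<^sup>2)"
  proof -
    have "A \<bullet> A = (\<Sum>i\<in>UNIV. \<Sum>j\<in>UNIV. ?S i j * (a i * a i))"
      by (simp only: U(2) inner_eigen_mat_same[OF U(1)] row)
    moreover have "gibbs Y \<bullet> gibbs Y = (\<Sum>i\<in>UNIV. \<Sum>j\<in>UNIV. ?S i j * (b j * b j))"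
      by (simp only: W(2) inner_eigen_mat_same[OF W(1)] col)
    moreover have "A \<bullet> gibbs Y = (\<Sum>i\<in>UNIV. \<Sum>j\<in>UNIV. ?S i j * (a i * b j))"
      by (simp only: U(2) W(2) inner_eigen_mat)
    ultimately show ?thesis
      by (simp add: sum_distrib_left sum_subtractf[symmetric] sum.distrib[symmetric]
          power2_eq_square algebra_simps)
  qed
  finally have "(norm (A - gibbs Y))\<^sup>2 / 2 = (\<Sum>i\<in>UNIV. \<Sum>j\<in>UNIV. ?S i j * ((a i - b j)\<^sup>2 / 2))"
    by (simp add: sum_divide_distrib)
  also have "\<dots> \<le> (\<Sum>i\<in>UNIV. \<Sum>j\<in>UNIV. ?S i j * (a i * ln (a i) - a i * ln (b j) - a i + b j))"
    using a b by (intro sum_mono mult_left_mono scalar_bregman overlap_nonneg) auto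
  also have "\<dots> = (\<Sum>i\<in>UNIV. \<Sum>j\<in>UNIV. ?S i j * (a i * ln (a i))) - (\<Sum>i\<in>UNIV. \<Sum>j\<in>UNIV. ?S i j * (a i * ln (b j)))
      - (\<Sum>i\<in>UNIV. \<Sum>j\<in>UNIV. ?S i j * a i) + (\<Sum>i\<in>UNIV. \<Sum>j\<in>UNIV. ?S i j * b j)"
    by (simp add: sum_subtractf[symmetric] sum.distrib[symmetric] algebra_simps)
  also have "\<dots> = A \<bullet> mlog A - A \<bullet> mlog (gibbs Y)"
    unfolding row col a(3) b(3) inner_eigen_mat[symmetric]
    by (simp add: U W mlog_eigen_mat inner_eigen_mat_same)
  finally show ?thesis by (simp add: rel_entropy_def inner_diff_right)
qed

lemma rel_entropy_gibbs_nonneg: "A \<in> spectrahedron \<Longrightarrow> hermitian Y \<Longrightarrow> 0 \<le> rel_entropy A (gibbs Y)"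
  by (rule order_trans[OF _ rel_entropy_gibbs_lower_bound]) auto

lemma rel_entropy_gibbs:
  assumes "A \<in> spectrahedron" "hermitian Y"
  shows "rel_entropy A (gibbs Y) = neg_entropy A - A \<bullet> Y + log_partition Y"
  using assms by (simp add: rel_entropy_def neg_entropy_inner spectrahedron_hermitian mlog_gibbs
      inner_diff_right spectrahedron_inner_mat_1)

text \<open>
  The three-point identity of mirror descent. With \<open>Y'\<close> the next dual iterate, the middle term is the
  first-order progress towards \<open>A\<close> and the last one the second-order error.
\<close>

lemma rel_entropy_three_point:
  assumes "A \<in> spectrahedron" "hermitian Y" "hermitian Y'"
  shows "rel_entropy A (gibbs Y') = rel_entropy A (gibbs Y) + (Y' - Y) \<bullet> (gibbs Y - A) + rel_entropy (gibbs Y) (gibbs Y')"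
  using assms by (simp add: rel_entropy_def mlog_gibbs inner_diff_right inner_diff_left
      spectrahedron_inner_mat_1 gibbs_in_spectrahedron inner_commute)

lemma rel_entropy_gibbs_symmetrised:
  assumes "hermitian Y" "hermitian Y'"
  shows "rel_entropy (gibbs Y) (gibbs Y') + rel_entropy (gibbs Y') (gibbs Y) = (Y - Y') \<bullet> (gibbs Y - gibbs Y')"
  using assms by (simp add: rel_entropy_def mlog_gibbs inner_diff_right inner_diff_left
      spectrahedron_inner_mat_1 gibbs_in_spectrahedron inner_commute)

text \<open>
  Strong convexity of the entropy is smoothness of its conjugate: the symmetrised relative entropy
  equals \<open>(Y - Y') \<bullet> (X - X')\<close> and is at least \<open>|X - X'|\<^sup>2\<close>, so Cauchy--Schwarz gives the Lipschitz
  bound with no need to differentiate the matrix exponential.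
\<close>

lemma gibbs_lipschitz:
  assumes "hermitian Y" "hermitian Y'"
  shows "norm (gibbs Y - gibbs Y') \<le> norm (Y - Y')"
proof -
  have "(norm (gibbs Y - gibbs Y'))\<^sup>2 \<le> (Y - Y') \<bullet> (gibbs Y - gibbs Y')"
    using rel_entropy_gibbs_symmetrised[OF assms] assms
      rel_entropy_gibbs_lower_bound[OF gibbs_in_spectrahedron[OF assms(1)] assms(2)]
      rel_entropy_gibbs_lower_bound[OF gibbs_in_spectrahedron[OF assms(2)] assms(1)]
    by (simp add: norm_minus_commute)
  also have "\<dots> \<le> norm (Y - Y') * norm (gibbs Y - gibbs Y')"
    by (rule norm_cauchy_schwarz)
  finally show ?thesis
    by (metis mult_right_le_imp_le norm_ge_zero order_le_less power2_eq_square)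
qed

lemma rel_entropy_gibbs_le:
  assumes "hermitian Y" "hermitian Y'"
  shows "rel_entropy (gibbs Y) (gibbs Y') \<le> (norm (Y - Y'))\<^sup>2"
proof -
  have "rel_entropy (gibbs Y) (gibbs Y') \<le> (Y - Y') \<bullet> (gibbs Y - gibbs Y')"
    using rel_entropy_gibbs_symmetrised[OF assms] assms
      rel_entropy_gibbs_nonneg[OF gibbs_in_spectrahedron[OF assms(2)] assms(1)] by linarith
  also have "\<dots> \<le> norm (Y - Y') * norm (gibbs Y - gibbs Y')"
    by (rule norm_cauchy_schwarz)
  also have "\<dots> \<le> norm (Y - Y') * norm (Y - Y')"
    by (intro mult_left_mono gibbs_lipschitz assms) simp
  finally show ?thesis by (simp add: power2_eq_square)
qed

lemma continuous_on_gibbs: "continuous_on {Y. hermitian Y} gibbs"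
proof (rule continuous_onI)
  fix Y e :: "complex^'n^'n" and \<epsilon> :: real assume "Y \<in> {Y. hermitian Y}" "\<epsilon> > 0"
  then show "\<exists>d>0. \<forall>Y'\<in>{Y. hermitian Y}. dist Y' Y < d \<longrightarrow> dist (gibbs Y') (gibbs Y) \<le> \<epsilon>"
    using gibbs_lipschitz by (intro exI[of _ \<epsilon>]) (force simp: dist_norm)
qed

text \<open>
  The Gibbs map is the gradient of the log-partition function, and the remainder of the first-order
  expansion is a relative entropy, which lies between \<open>0\<close> and \<open>|Y - Y'|\<^sup>2\<close>.
\<close>

lemma continuous_on_log_partition: "continuous_on {Y. hermitian Y} log_partition"
proof (rule continuous_onI)
  fix Y :: "complex^'n^'n" and \<epsilon> :: real assume Y: "Y \<in> {Y. hermitian Y}" and e: "\<epsilon> > 0"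
  have main: "\<bar>log_partition Y' - log_partition Y\<bar> \<le> norm (Y' - Y) * norm (gibbs Y) + (norm (Y' - Y))\<^sup>2"
    if Y': "hermitian Y'" for Y'
  proof -
    have "rel_entropy (gibbs Y) (gibbs Y') = gibbs Y \<bullet> Y - gibbs Y \<bullet> Y' + log_partition Y' - log_partition Y"
      using Y Y' rel_entropy_gibbs[of "gibbs Y" Y] by (simp add: rel_entropy_gibbs gibbs_in_spectrahedron)
    moreover have "\<bar>gibbs Y \<bullet> Y' - gibbs Y \<bullet> Y\<bar> \<le> norm (Y' - Y) * norm (gibbs Y)"
      using Cauchy_Schwarz_ineq2[of "gibbs Y" "Y' - Y"] by (simp add: inner_diff_right mult.commute)
    moreover have "0 \<le> rel_entropy (gibbs Y) (gibbs Y')" "rel_entropy (gibbs Y) (gibbs Y') \<le> (norm (Y' - Y))\<^sup>2"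
      using Y Y' rel_entropy_gibbs_le[of Y Y'] by (auto simp: rel_entropy_gibbs_nonneg gibbs_in_spectrahedron norm_minus_commute)
    ultimately show ?thesis by linarith
  qed
  have "((\<lambda>t. t * norm (gibbs Y) + t\<^sup>2) \<longlongrightarrow> 0 * norm (gibbs Y) + 0\<^sup>2) (at 0)"
    by (intro tendsto_intros)
  then obtain d where "d > 0" and d: "\<And>t. t \<noteq> 0 \<Longrightarrow> \<bar>t\<bar> < d \<Longrightarrow> \<bar>t * norm (gibbs Y) + t\<^sup>2\<bar> < \<epsilon>"
    using e by (auto simp: LIM_def dist_real_def) 
  show "\<exists>d>0. \<forall>Y'\<in>{Y. hermitian Y}. dist Y' Y < d \<longrightarrow> dist (log_partition Y') (log_partition Y) \<le> \<epsilon>"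
  proof (intro exI[of _ d] conjI ballI impI)
    fix Y' assume Y': "Y' \<in> {Y. hermitian Y}" "dist Y' Y < d"
    show "dist (log_partition Y') (log_partition Y) \<le> \<epsilon>"
    proof (cases "Y' = Y")
      case False
      then show ?thesis
        using main[of Y'] d[of "norm (Y' - Y)"] Y' by (simp add: dist_norm)
    qed (use e in simp)
  qed fact
qed

lemma neg_entropy_nonpos:
  assumes "X \<in> spectrahedron"
  shows "neg_entropy X \<le> 0"
proof -
  obtain U d where X: "unitary U" "X = eigen_mat U d" and d: "\<And>i. 0 \<le> d i" "\<And>i. d i \<le> 1"
    using spectrahedron_eigen_matE[OF assms] by metis
  have "neg_entropy X = (\<Sum>i\<in>UNIV. d i * ln (d i))"
    by (simp add: neg_entropy_inner hermitian_eigen_mat X mlog_eigen_mat inner_eigen_mat_same)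
  also have "\<dots> \<le> 0"
  proof (intro sum_nonpos mult_nonneg_nonpos d)
    show "ln (d i) \<le> 0" for i
      using d[of i] by (cases "d i = 0") auto
  qed
  finally show ?thesis .
qed

lemma neg_entropy_ge:
  assumes "X \<in> spectrahedron"
  shows "- log_partition (0 :: complex^'n^'n) \<le> neg_entropy (X :: complex^'n^'n)"
  using rel_entropy_gibbs_nonneg[OF assms, of 0] rel_entropy_gibbs[OF assms, of 0] by simp

section \<open>Gradients of convex functions\<close>

lemma is_gradient_hermitian: "is_gradient g G \<Longrightarrow> X \<in> spectrahedron \<Longrightarrow> hermitian (G X)"
  by (simp add: is_gradient_def)

lemma is_gradient_has_derivative:
  assumes "is_gradient g G" "X \<in> spectrahedron"
  shows "(g has_derivative (\<lambda>H. G X \<bullet> H)) (at X within spectrahedron)"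
proof -
  have "(\<lambda>H. Re (trace (G X ** H))) = (\<lambda>H. G X \<bullet> H)"
    using assms by (simp add: is_gradient_def inner_hermitian)
  with assms show ?thesis by (metis is_gradient_def)
qed

lemma is_gradient_continuous_on:
  assumes "is_gradient g G"
  shows "continuous_on spectrahedron g"
  using is_gradient_has_derivative[OF assms]
  by (auto simp: continuous_on_eq_continuous_within intro: has_derivative_continuous)

text \<open>
  The derivative is only taken within the spectrahedron, so the usual first-order characterisation of
  convexity is obtained along the segment from \<open>X\<close> to \<open>Z\<close>, as a one-sided limit of difference
  quotients.
\<close>

lemma gradient_inequality:
  assumes conv: "convex_on spectrahedron g" and grad: "is_gradient g G"
    and X: "X \<in> spectrahedron" and Z: "Z \<in> spectrahedron"
  shows "G X \<bullet> (Z - X) \<le> g Z - g X"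
proof -
  define c where "c t = X + t *\<^sub>R (Z - X)" for t :: real
  have c_alt: "c t = (1 - t) *\<^sub>R X + t *\<^sub>R Z" for t
    by (simp add: c_def algebra_simps)
  have c_in: "c ` {0..1} \<subseteq> spectrahedron"
    using convexD_alt[OF convex_spectrahedron X Z] by (auto simp: c_alt)
  have dc: "(c has_derivative (\<lambda>t. t *\<^sub>R (Z - X))) (at 0 within {0..1})"
    unfolding c_def by (auto intro!: derivative_eq_intros)
  have "(g has_derivative (\<lambda>H. G X \<bullet> H)) (at (c 0) within c ` {0..1})"
    using has_derivative_subset[OF is_gradient_has_derivative[OF grad X] c_in] by (simp add: c_def)
  from has_derivative_in_compose[OF dc this]
  have "((\<lambda>t. g (c t)) has_derivative (\<lambda>t. G X \<bullet> (t *\<^sub>R (Z - X)))) (at 0 within {0..1})" .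
  then have "((\<lambda>t. g (c t)) has_real_derivative G X \<bullet> (Z - X)) (at 0 within {0..1})"
    by (simp add: has_field_derivative_def mult.commute[of _ "G X \<bullet> (Z - X)"] mult_commute_abs)
  then have lim: "((\<lambda>t. (g (c t) - g X) / t) \<longlongrightarrow> G X \<bullet> (Z - X)) (at 0 within {0..1})"
    by (simp add: has_field_derivative_iff c_def)
  have "\<forall>\<^sub>F t in at 0 within {0..1}. (g (c t) - g X) / t \<le> g Z - g X"
    unfolding eventually_at_filter
  proof (intro always_eventually allI impI)
    fix t :: real assume t: "t \<noteq> 0" "t \<in> {0..1}"
    have "g (c t) \<le> (1 - t) * g X + t * g Z"
      using convex_onD[OF conv _ _ X Z, of t] t by (simp add: c_alt)
    then have "g (c t) - g X \<le> (g Z - g X) * t"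
      by (simp add: algebra_simps)
    then show "(g (c t) - g X) / t \<le> g Z - g X"
      using t by (simp add: pos_divide_le_eq)
  qed
  moreover have "at (0::real) within {0..1} \<noteq> bot"
    by (simp add: at_within_Icc_at_right)
  ultimately show ?thesis using tendsto_upperbound[OF lim] by blast
qed

section \<open>The entropically regularised problem\<close>

text \<open>
  For Hermitian \<open>G(p)\<close>, the condition says that \<open>- G(p) / \<tau>\<close> equals \<open>log p\<close> up to a multiple of the
  identity. For a gradient field \<open>G\<close> of \<open>g\<close> this
  is the first-order optimality condition for \<open>g + \<tau> tr[X log X]\<close>, whose minimisers lie in the
  interior.
\<close>

definition gibbs_equilibrium where
  "gibbs_equilibrium G \<tau> p \<longleftrightarrow> p \<in> spectrahedron \<and> p = gibbs (- (1 / \<tau>) *\<^sub>R G p)"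

text \<open>
  Brouwer's theorem for the continuous map \<open>X \<mapsto> gibbs (- G(X) / \<tau>)\<close>. When \<open>G\<close> is a gradient
  field and \<open>\<tau> > 0\<close>, this yields a minimiser of the perturbed problem directly in Gibbs form.
\<close>

lemma gibbs_equilibrium_exists:
  fixes G :: "complex^'n^'n \<Rightarrow> complex^'n^'n"
  assumes "continuous_on spectrahedron G" and herm: "\<And>X. X \<in> spectrahedron \<Longrightarrow> hermitian (G X)"
  shows "\<exists>p. gibbs_equilibrium G \<tau> p"
proof -
  let ?T = "\<lambda>X. gibbs (- (1 / \<tau>) *\<^sub>R G X)"
  have "continuous_on spectrahedron ?T"
    by (rule continuous_on_compose2[OF continuous_on_gibbs])
      (use herm in \<open>auto intro!: continuous_intros assms(1) hermitian_scaleR simp del: scaleR_minus_left\<close>)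
  moreover have "?T X \<in> spectrahedron" if "X \<in> spectrahedron" for X
    by (intro gibbs_in_spectrahedron hermitian_scaleR herm that)
  moreover have "(spectrahedron :: (complex^'n^'n) set) \<noteq> {}"
    using gibbs_in_spectrahedron[OF hermitian_0] by blast
  ultimately obtain p where "p \<in> spectrahedron" "?T p = p"
    using brouwer[OF compact_spectrahedron convex_spectrahedron, of ?T] by blast
  then show ?thesis by (metis gibbs_equilibrium_def)
qed

text \<open>
  Nonnegativity of the relative entropy of \<open>X\<close> from \<open>p\<close> is the subgradient inequality for the entropy
  at \<open>p\<close>; the subgradient is \<open>- G(p) / \<tau>\<close>, which cancels the gradient inequality for \<open>g\<close>.
\<close>

lemma gibbs_equilibrium_minimises:
  assumes conv: "convex_on spectrahedron g" and grad: "is_gradient g G" and tau: "\<tau> > 0"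
    and p: "gibbs_equilibrium G \<tau> p" and X: "X \<in> spectrahedron"
  shows "g p + \<tau> * neg_entropy p \<le> g X + \<tau> * neg_entropy X"
proof -
  define Y where "Y = - (1 / \<tau>) *\<^sub>R G p"
  have pS: "p \<in> spectrahedron" and pY: "gibbs Y = p"
    using p by (simp_all add: gibbs_equilibrium_def Y_def)
  have Y: "hermitian Y"
    unfolding Y_def by (intro hermitian_scaleR is_gradient_hermitian[OF grad pS])
  have "0 \<le> rel_entropy X (gibbs Y)"
    by (rule rel_entropy_gibbs_nonneg[OF X Y])
  moreover have "rel_entropy p (gibbs Y) = 0"
    by (simp add: pY)
  ultimately have "Y \<bullet> (X - p) \<le> neg_entropy X - neg_entropy p"
    by (simp add: rel_entropy_gibbs X Y pS inner_diff_right inner_commute[of Y])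
  then have "\<tau> * (Y \<bullet> (X - p)) \<le> \<tau> * (neg_entropy X - neg_entropy p)"
    using tau by simp
  moreover have "\<tau> * (Y \<bullet> (X - p)) = - (G p \<bullet> (X - p))"
    using tau by (simp add: Y_def)
  ultimately show ?thesis
    using gradient_inequality[OF conv grad pS X] by (simp add: algebra_simps)
qed

text \<open>
  The estimate that makes the relative entropy from \<open>p\<close> a Lyapunov function. Gradients of a convex
  function are monotone, and the regularisation contributes \<open>\<tau>\<close> times the symmetrised relative
  entropy. The two gradient fields may differ by multiples of the identity.
\<close>

lemma gibbs_equilibrium_drift:
  assumes conv: "convex_on spectrahedron g" and grad: "is_gradient g G" "is_gradient g V"
    and tau: "\<tau> > 0" and p: "gibbs_equilibrium G \<tau> p" and Y: "hermitian Y"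
  shows "\<tau> * rel_entropy p (gibbs Y) \<le> (V (gibbs Y) + \<tau> *\<^sub>R Y) \<bullet> (gibbs Y - p)"
proof -
  define Y0 where "Y0 = - (1 / \<tau>) *\<^sub>R G p"
  have pS: "p \<in> spectrahedron" and pY: "gibbs Y0 = p"
    using p by (simp_all add: gibbs_equilibrium_def Y0_def)
  have Y0: "hermitian Y0"
    unfolding Y0_def by (intro hermitian_scaleR is_gradient_hermitian[OF grad(1) pS])
  have XS: "gibbs Y \<in> spectrahedron"
    by (rule gibbs_in_spectrahedron[OF Y])
  have "V (gibbs Y) \<bullet> (p - gibbs Y) + G p \<bullet> (gibbs Y - p) \<le> 0"
    using gradient_inequality[OF conv grad(2) XS pS] gradient_inequality[OF conv grad(1) pS XS] by simp
  moreover have "G p = - \<tau> *\<^sub>R Y0"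
    using tau by (simp add: Y0_def)
  ultimately have V: "0 \<le> V (gibbs Y) \<bullet> (gibbs Y - p) + \<tau> * (Y0 \<bullet> (gibbs Y - p))"
    by (simp add: inner_diff_right algebra_simps)
  have "rel_entropy (gibbs Y) p + rel_entropy p (gibbs Y) = (Y - Y0) \<bullet> (gibbs Y - p)"
    using rel_entropy_gibbs_symmetrised[OF Y Y0] by (simp add: pY)
  moreover have "0 \<le> rel_entropy (gibbs Y) p"
    using rel_entropy_gibbs_nonneg[OF XS Y0] by (simp add: pY)
  ultimately have "rel_entropy p (gibbs Y) \<le> (Y - Y0) \<bullet> (gibbs Y - p)"
    by linarith
  then have "\<tau> * rel_entropy p (gibbs Y) \<le> \<tau> * ((Y - Y0) \<bullet> (gibbs Y - p))"
    using tau by simp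
  with V show ?thesis
    by (simp only: inner_add_left inner_diff_left right_diff_distrib inner_scaleR_left)
qed

section \<open>Vanishing temperature\<close>

lemma argmin_closed_nonempty:
  fixes g :: "'b::euclidean_space \<Rightarrow> real"
  assumes "compact S" "S \<noteq> {}" "continuous_on S g"
  shows "closed {x. is_arg_min g (\<lambda>x. x \<in> S) x}" "{x. is_arg_min g (\<lambda>x. x \<in> S) x} \<noteq> {}"
proof -
  obtain m where m: "m \<in> S" "\<And>y. y \<in> S \<Longrightarrow> g m \<le> g y"
    using continuous_attains_inf[OF assms] by blast
  then have eq: "{x. is_arg_min g (\<lambda>x. x \<in> S) x} = {x \<in> S. g x \<le> g m}"
    by (fastforce simp: is_arg_min_linorder)
  show "{x. is_arg_min g (\<lambda>x. x \<in> S) x} \<noteq> {}"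
    using m(1) unfolding eq by auto
  have "closed {x \<in> S. g x \<le> g m}"
    using continuous_closed_preimage[OF assms(3) compact_imp_closed[OF assms(1)], of "{..g m}"]
    by (simp add: vimage_def Int_def)
  then show "closed {x. is_arg_min g (\<lambda>x. x \<in> S) x}" by (simp add: eq)
qed

text \<open>
  Points at distance at least \<open>e\<close> from the minimisers of \<open>g\<close> form a compact set, on which \<open>g\<close> exceeds
  its minimum by a positive gap. A perturbation by \<open>\<tau> h\<close> with \<open>h\<close> bounded cannot bridge the gap once
  \<open>\<tau>\<close> is small.
\<close>

lemma perturbed_minimisers_approach_argmin:
  fixes g h :: "'b::euclidean_space \<Rightarrow> real" and p :: "real \<Rightarrow> 'b"
  assumes S: "compact S" "S \<noteq> {}" and g: "continuous_on S g"
    and h: "\<And>x. x \<in> S \<Longrightarrow> \<bar>h x\<bar> \<le> B"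
    and pS: "\<And>\<tau>. \<tau> > 0 \<Longrightarrow> p \<tau> \<in> S"
    and pmin: "\<And>\<tau> x. \<tau> > 0 \<Longrightarrow> x \<in> S \<Longrightarrow> g (p \<tau>) + \<tau> * h (p \<tau>) \<le> g x + \<tau> * h x"
  shows "((\<lambda>\<tau>. infdist (p \<tau>) {x. is_arg_min g (\<lambda>x. x \<in> S) x}) \<longlongrightarrow> 0) (at_right 0)"
proof (rule tendstoI)
  fix e :: real assume e: "e > 0"
  let ?M = "{x. is_arg_min g (\<lambda>x. x \<in> S) x}"
  obtain m where m: "is_arg_min g (\<lambda>x. x \<in> S) m"
    using argmin_closed_nonempty(2)[OF S g] by blast
  define K where "K = S \<inter> {x. e \<le> infdist x ?M}"
  have "closed {x. e \<le> infdist x ?M}"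
    by (intro closed_Collect_le continuous_intros)
  then have K: "compact K" unfolding K_def by (rule compact_Int_closed[OF S(1)])
  obtain b where b: "b > g m" "\<And>x. x \<in> K \<Longrightarrow> b \<le> g x"
  proof (cases "K = {}")
    case True
    then show ?thesis using that[of "g m + 1"] by simp
  next
    case False
    then obtain k where k: "k \<in> K" "\<And>x. x \<in> K \<Longrightarrow> g k \<le> g x"
      using continuous_attains_inf[OF K False continuous_on_subset[OF g]] by (auto simp: K_def)
    have "g k > g m"
    proof (rule ccontr)
      assume "\<not> g k > g m"
      then have "k \<in> ?M"
        using m k(1) by (auto simp: is_arg_min_linorder K_def intro: order_trans)
      then have "infdist k ?M = 0" by (rule infdist_zero)
      with k(1) e show False by (simp add: K_def)
    qed
    with that k show ?thesis by blast
  qed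
  define r where "r = (b - g m) / (2 * \<bar>B\<bar> + 1)"
  have r: "r > 0" using b(1) by (simp add: r_def)
  have "dist (infdist (p \<tau>) ?M) 0 < e" if "0 < \<tau>" "\<tau> < r" for \<tau>
  proof (rule ccontr)
    assume "\<not> dist (infdist (p \<tau>) ?M) 0 < e"
    then have "p \<tau> \<in> K" using pS that by (simp add: K_def infdist_nonneg)
    then have "b \<le> g (p \<tau>)" by (rule b)
    also have "g (p \<tau>) \<le> g m + \<tau> * (h m - h (p \<tau>))"
      using pmin[OF that(1), of m] m by (simp add: is_arg_min_linorder algebra_simps)
    also have "\<dots> \<le> g m + \<tau> * (2 * \<bar>B\<bar>)"
      using h[of m] h[of "p \<tau>"] pS[OF that(1)] m that(1) by (intro add_left_mono mult_left_mono) (auto simp: is_arg_min_linorder)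
    also have "\<dots> \<le> g m + \<tau> * (2 * \<bar>B\<bar> + 1)"
      using that(1) by simp
    also have "\<dots> < g m + r * (2 * \<bar>B\<bar> + 1)"
      using that(2) by (intro add_strict_left_mono mult_strict_right_mono) auto
    also have "\<dots> = b" by (simp add: r_def)
    finally show False by simp
  qed
  then show "\<forall>\<^sub>F \<tau> in at_right 0. dist (infdist (p \<tau>) ?M) 0 < e"
    using r by (auto simp: eventually_at_right_field)
qed

section \<open>Equivalence of norms on Hermitian matrices\<close>

text \<open>
  The norm \<open>N\<close> is only meaningful on the real subspace of Hermitian matrices. The
  symmetrisation \<open>s\<close> maps a real basis of all matrices onto a spanning set of this subspace.
\<close>

lemma hermitian_norm_le_Frobenius:
  fixes N :: "complex^'n^'n \<Rightarrow> real"
  assumes "hermitian_norm N"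
  obtains K where "K > 0" "\<And>A. hermitian A \<Longrightarrow> N A \<le> K * norm A"
proof -
  define s :: "complex^'n^'n \<Rightarrow> complex^'n^'n" where "s A = (1 / 2) *\<^sub>R (A + adj A)" for A
  have herm: "hermitian (s A)" for A
    by (simp add: s_def hermitian_def vec_eq_iff add.commute)
  have lin: "linear s"
    by (rule linearI) (simp_all add: s_def vec_eq_iff algebra_simps)
  have tri: "N (A + B) \<le> N A + N B" and hom: "N (c *\<^sub>R A) = \<bar>c\<bar> * N A"
    if "hermitian A" "hermitian B" for A B c
    using assms that by (auto simp: hermitian_norm_def)
  have N0: "N 0 = 0" using assms by (simp add: hermitian_norm_def)
  have nonneg: "0 \<le> N A" if A: "hermitian A" for A
    using tri[OF A hermitian_scaleR[OF A], of "-1"] hom[OF A A, of "-1"] N0 by simp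
  have fin: "hermitian (\<Sum>b\<in>I. f b) \<and> N (\<Sum>b\<in>I. f b) \<le> (\<Sum>b\<in>I. N (f b))"
    if "finite I" "\<And>b. hermitian (f b)" for I :: "(complex^'n^'n) set" and f
    using that(1)
  proof induction
    case (insert b I)
    then show ?case using tri[OF that(2)[of b], of "sum f I"] that(2)[of b] by (simp add: hermitian_add)
  qed (simp add: N0)
  define K where "K = (\<Sum>b\<in>Basis. N (s b)) + 1"
  have "N A \<le> K * norm A" if A: "hermitian A" for A
  proof -
    have "A = s A" using A by (simp add: s_def hermitian_def scaleR_2[symmetric])
    also have "\<dots> = s (\<Sum>b\<in>Basis. (A \<bullet> b) *\<^sub>R b)" by (simp add: euclidean_representation)
    also have "\<dots> = (\<Sum>b\<in>Basis. (A \<bullet> b) *\<^sub>R s b)"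
      by (simp add: linear_sum[OF lin] linear_cmul[OF lin])
    finally have "N A \<le> (\<Sum>b\<in>Basis. N ((A \<bullet> b) *\<^sub>R s b))"
      using fin[of Basis "\<lambda>b. (A \<bullet> b) *\<^sub>R s b"] herm by (simp add: hermitian_scaleR)
    also have "\<dots> = (\<Sum>b\<in>Basis. \<bar>A \<bullet> b\<bar> * N (s b))"
      by (simp add: hom[OF herm herm])
    also have "\<dots> \<le> (\<Sum>b\<in>Basis. norm A * N (s b))"
      by (intro sum_mono mult_right_mono Basis_le_norm nonneg herm)
    also have "\<dots> \<le> K * norm A"
      by (simp add: K_def sum_distrib_left[symmetric] algebra_simps)
    finally show ?thesis .
  qed
  moreover have "K > 0"
    unfolding K_def by (intro add_nonneg_pos sum_nonneg nonneg herm) simp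
  ultimately show thesis using that by blast
qed

lemma Frobenius_le_hermitian_norm:
  fixes N :: "complex^'n^'n \<Rightarrow> real"
  assumes N: "hermitian_norm N"
  obtains c where "c > 0" "\<And>A. hermitian A \<Longrightarrow> norm A \<le> c * N A"
proof -
  obtain K where K: "K > 0" "\<And>A. hermitian A \<Longrightarrow> N A \<le> K * norm A"
    using hermitian_norm_le_Frobenius[OF N] by blast
  have tri: "N (A + B) \<le> N A + N B" and hom: "N (c *\<^sub>R A) = \<bar>c\<bar> * N A" and zero: "N A = 0 \<longleftrightarrow> A = 0"
    if "hermitian A" "hermitian B" for A B c
    using assms that by (auto simp: hermitian_norm_def)
  have nonneg: "0 \<le> N A" if A: "hermitian A" for A
    using tri[OF A hermitian_scaleR[OF A], of "-1"] hom[OF A A, of "-1"] zero[OF hermitian_0 hermitian_0] by simp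
  have lip: "N A - N B \<le> K * norm (A - B)" if "hermitian A" "hermitian B" for A B
    using tri[OF that(2) hermitian_diff[OF that]] K(2)[OF hermitian_diff[OF that]] by simp
  let ?S = "{A :: complex^'n^'n. hermitian A} \<inter> sphere 0 1"
  have "continuous_on ?S N"
  proof (rule continuous_onI)
    fix A :: "complex^'n^'n" and e :: real assume A: "A \<in> ?S" "e > 0"
    have "dist (N B) (N A) \<le> e" if "B \<in> ?S" "dist B A < e / K" for B
    proof -
      have "K * norm (B - A) \<le> e" using that(2) K(1) by (simp add: dist_norm field_simps)
      then show ?thesis
        using lip[of A B] lip[of B A] A(1) that(1) by (simp add: dist_real_def norm_minus_commute abs_le_iff)
    qed
    then show "\<exists>d>0. \<forall>B\<in>?S. dist B A < d \<longrightarrow> dist (N B) (N A) \<le> e"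
      using A(2) K(1) by (intro exI[of _ "e / K"]) auto
  qed
  moreover have "compact ?S"
    by (rule closed_Int_compact[OF closed_hermitian]) simp
  moreover have "(mat 1 :: complex^'n^'n) \<noteq> 0"
    by (simp add: vec_eq_iff mat_def)
  then have "(1 / norm (mat 1 :: complex^'n^'n)) *\<^sub>R mat 1 \<in> ?S"
    by (simp add: hermitian_scaleR)
  ultimately obtain m where m: "m \<in> ?S" "\<And>A. A \<in> ?S \<Longrightarrow> N m \<le> N A"
    using continuous_attains_inf[of ?S N] by blast
  have pos: "N m > 0"
    using nonneg[of m] zero[of m m] m(1) by (auto simp: order_less_le)
  have "norm A \<le> (1 / N m) * N A" if A: "hermitian A" for A
  proof (cases "A = 0")
    case False
    then have "N m \<le> N ((1 / norm A) *\<^sub>R A)"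
      using A by (intro m) (simp add: hermitian_scaleR)
    then show ?thesis
      using pos False by (simp add: hom[OF A A] field_simps)
  qed (use zero[OF hermitian_0 hermitian_0] in simp)
  then show thesis using that[of "1 / N m"] pos by simp
qed

section \<open>Nonnegative supermartingales\<close>

text \<open>
  Ville's inequality. Let \<open>A m\<close> be the event that the level is reached between times \<open>n\<close> and \<open>n + m\<close>.
  Then \<open>\<epsilon> P(A m) + E[W\<^sub>n\<^sub>+\<^sub>m; not A m]\<close> does not increase with \<open>m\<close>: the supermartingale property is
  applied on the complement of \<open>A m\<close>, and paths that cross at the next time are charged \<open>\<epsilon>\<close> each.
  The supermartingale property is stated through integrals over events, which avoids conditional
  expectations.
\<close>

lemma (in prob_space) supermartingale_maximal_inequality:
  fixes W :: "nat \<Rightarrow> 'a \<Rightarrow> real"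
  assumes sub: "\<And>k. subalgebra M (F k)" and mono: "\<And>k. sets (F k) \<subseteq> sets (F (Suc k))"
    and adapted: "\<And>k. W k \<in> borel_measurable (F k)"
    and int: "\<And>k. integrable M (W k)"
    and nonneg: "\<And>k \<omega>. \<omega> \<in> space M \<Longrightarrow> 0 \<le> W k \<omega>"
    and super: "\<And>k A. A \<in> sets (F k) \<Longrightarrow>
      (\<integral>\<omega>. indicator A \<omega> * W (Suc k) \<omega> \<partial>M) \<le> (\<integral>\<omega>. indicator A \<omega> * W k \<omega> \<partial>M)"
    and e: "\<epsilon> > 0"
  shows "\<epsilon> * prob {\<omega> \<in> space M. \<exists>k\<ge>n. \<epsilon> \<le> W k \<omega>} \<le> expectation (W n)"
proof -
  define A where "A m = {\<omega> \<in> space M. \<exists>k. n \<le> k \<and> k \<le> n + m \<and> \<epsilon> \<le> W k \<omega>}" for m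
  define L where "L k = {\<omega> \<in> space M. \<epsilon> \<le> W k \<omega>}" for k
  have spF: "space (F k) = space M" for k
    using sub[of k] by (simp add: subalgebra_def)
  have L_F: "L k \<in> sets (F k)" for k
    using adapted[of k] borel_measurable_iff_ge[of "W k" "F k"] by (simp add: L_def spF)
  have F_M: "B \<in> sets (F k) \<Longrightarrow> B \<in> sets M" for B k
    using sub[of k] by (auto simp: subalgebra_def)
  have A0: "A 0 = L n"
    by (auto simp: A_def L_def)
  have ASuc: "A (Suc m) = A m \<union> L (Suc (n + m))" for m
    by (auto simp: A_def L_def le_Suc_eq) (metis le_SucI le_add1)
  have A_F: "A m \<in> sets (F (n + m))" for m
  proof (induction m)
    case 0
    then show ?case using L_F[of n] by (simp add: A0)
  next
    case (Suc m)
    then show ?case using mono[of "n + m"] L_F[of "Suc (n + m)"] by (auto simp: ASuc)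
  qed
  have int': "integrable M (\<lambda>\<omega>. indicator B \<omega> * W k \<omega>)" if "B \<in> sets M" for B k
    using integrable_mult_indicator[OF that int[of k]] by simp
  have markov: "\<epsilon> * prob B \<le> (\<integral>\<omega>. indicator B \<omega> * W k \<omega> \<partial>M)" if "B \<in> sets M" "B \<subseteq> L k" for B k
  proof -
    have "\<epsilon> * prob B = (\<integral>\<omega>. \<epsilon> * indicator B \<omega> \<partial>M)"
      using that(1) by simp
    also have "\<dots> \<le> (\<integral>\<omega>. indicator B \<omega> * W k \<omega> \<partial>M)"
    proof (rule integral_mono)
      show "integrable M (\<lambda>\<omega>. \<epsilon> * indicator B \<omega>)"
        using that(1) by (intro integrable_mult_right integrable_real_indicator) (auto simp: emeasure_eq_measure)
      show "\<epsilon> * indicator B \<omega> \<le> indicator B \<omega> * W k \<omega>" if "\<omega> \<in> space M" for \<omega>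
        using \<open>B \<subseteq> L k\<close> by (auto simp: L_def split: split_indicator)
    qed (rule int'[OF that(1)])
    finally show ?thesis .
  qed
  have split: "(\<integral>\<omega>. indicator C \<omega> * W k \<omega> \<partial>M)
      = (\<integral>\<omega>. indicator (C \<inter> B) \<omega> * W k \<omega> \<partial>M) + (\<integral>\<omega>. indicator (C - B) \<omega> * W k \<omega> \<partial>M)"
    if "B \<in> sets M" "C \<in> sets M" for B C k
    using that by (subst Bochner_Integration.integral_add[symmetric])
      (auto intro!: int' Bochner_Integration.integral_cong split: split_indicator)
  have main: "\<epsilon> * prob (A m) + (\<integral>\<omega>. indicator (space M - A m) \<omega> * W (n + m) \<omega> \<partial>M) \<le> expectation (W n)" for m
  proof (induction m)
    case 0
    have "expectation (W n) = (\<integral>\<omega>. indicator (space M) \<omega> * W n \<omega> \<partial>M)"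
      by (intro Bochner_Integration.integral_cong) auto
    also have "\<dots> = (\<integral>\<omega>. indicator (A 0) \<omega> * W n \<omega> \<partial>M) + (\<integral>\<omega>. indicator (space M - A 0) \<omega> * W n \<omega> \<partial>M)"
    proof -
      have "space M \<inter> A 0 = A 0" unfolding A_def by blast
      then show ?thesis using split[OF F_M[OF A_F[of 0]] sets.top, of n] by simp
    qed
    finally show ?case
      using markov[OF F_M[OF A_F[of 0]], of n] A0 by simp
  next
    case (Suc m)
    let ?C = "space M - A m" and ?L = "L (Suc (n + m))"
    have M: "A m \<in> sets M" "?L \<in> sets M" "?C \<in> sets M"
      using F_M[OF A_F[of m]] F_M[OF L_F] by auto
    have "?C \<in> sets (F (n + m))"
      using A_F[of m] by (metis sets.compl_sets spF)
    from super[OF this]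
    have "(\<integral>\<omega>. indicator ?C \<omega> * W (Suc (n + m)) \<omega> \<partial>M) \<le> (\<integral>\<omega>. indicator ?C \<omega> * W (n + m) \<omega> \<partial>M)" .
    moreover have "\<epsilon> * prob (?C \<inter> ?L) \<le> (\<integral>\<omega>. indicator (?C \<inter> ?L) \<omega> * W (Suc (n + m)) \<omega> \<partial>M)"
      using M by (intro markov) auto
    moreover have "prob (A (Suc m)) = prob (A m) + prob (?C \<inter> ?L)"
    proof -
      have "A (Suc m) = A m \<union> (?C \<inter> ?L)" by (auto simp: ASuc L_def)
      moreover have "A m \<inter> (?C \<inter> ?L) = {}" by blast
      ultimately show ?thesis
        using finite_measure_Union[OF M(1) sets.Int[OF M(3,2)]] by simp
    qed
    moreover have "space M - A (Suc m) = ?C - ?L" by (auto simp: ASuc)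
    ultimately show ?case
      using Suc split[OF M(2,3), of "Suc (n + m)"] by (simp add: distrib_left)
  qed
  have bound: "\<epsilon> * prob (A m) \<le> expectation (W n)" for m
  proof -
    have "0 \<le> (\<integral>\<omega>. indicator (space M - A m) \<omega> * W (n + m) \<omega> \<partial>M)"
      using nonneg by (intro Bochner_Integration.integral_nonneg) (auto split: split_indicator)
    with main[of m] show ?thesis by linarith
  qed
  have "(\<lambda>m. prob (A m)) \<longlonglongrightarrow> prob (\<Union>m. A m)"
  proof (rule finite_Lim_measure_incseq)
    show "range A \<subseteq> sets M" using F_M[OF A_F] by blast
    show "incseq A" by (rule incseq_SucI) (simp add: ASuc)
  qed
  moreover have "(\<Union>m. A m) = {\<omega> \<in> space M. \<exists>k\<ge>n. \<epsilon> \<le> W k \<omega>}"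
    by (auto simp: A_def) (metis le_add_diff_inverse order_refl)
  ultimately have "(\<lambda>m. \<epsilon> * prob (A m)) \<longlonglongrightarrow> \<epsilon> * prob {\<omega> \<in> space M. \<exists>k\<ge>n. \<epsilon> \<le> W k \<omega>}"
    by (intro tendsto_intros) simp
  then show ?thesis by (rule LIMSEQ_le_const2) (use bound in blast)
qed

text \<open>
  If the expectations tend to zero, the maximal inequality over all times after \<open>n\<close> tends to zero with
  \<open>n\<close>. This gives almost sure convergence without a martingale convergence theorem.
\<close>

lemma (in prob_space) supermartingale_AE_tendsto_0:
  fixes W :: "nat \<Rightarrow> 'a \<Rightarrow> real"
  assumes sub: "\<And>k. subalgebra M (F k)" and mono: "\<And>k. sets (F k) \<subseteq> sets (F (Suc k))"
    and adapted: "\<And>k. W k \<in> borel_measurable (F k)"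
    and int: "\<And>k. integrable M (W k)"
    and nonneg: "\<And>k \<omega>. \<omega> \<in> space M \<Longrightarrow> 0 \<le> W k \<omega>"
    and super: "\<And>k A. A \<in> sets (F k) \<Longrightarrow>
      (\<integral>\<omega>. indicator A \<omega> * W (Suc k) \<omega> \<partial>M) \<le> (\<integral>\<omega>. indicator A \<omega> * W k \<omega> \<partial>M)"
    and lim: "(\<lambda>n. expectation (W n)) \<longlonglongrightarrow> 0"
  shows "AE \<omega> in M. (\<lambda>n. W n \<omega>) \<longlonglongrightarrow> 0"
proof -
  have [measurable]: "W k \<in> borel_measurable M" for k
    using int by (rule borel_measurable_integrable)
  have null: "AE \<omega> in M. \<exists>n. \<forall>k\<ge>n. W k \<omega> < \<epsilon>" if e: "\<epsilon> > 0" for \<epsilon>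
  proof -
    define S where "S n = {\<omega> \<in> space M. \<exists>k\<ge>n. \<epsilon> \<le> W k \<omega>}" for n
    have S[measurable]: "S n \<in> sets M" for n unfolding S_def by measurable
    have T: "(\<Inter>n. S n) \<in> sets M" by measurable
    have "prob (\<Inter>n. S n) \<le> expectation (W n) / \<epsilon>" for n
    proof -
      have "prob (\<Inter>n. S n) \<le> prob (S n)"
        by (intro finite_measure_mono S) auto
      moreover have "\<epsilon> * prob (S n) \<le> expectation (W n)"
        unfolding S_def by (rule supermartingale_maximal_inequality[of F]) (fact assms e)+
      ultimately have "\<epsilon> * prob (\<Inter>n. S n) \<le> expectation (W n)"
        using e by (meson less_imp_le mult_left_mono order_trans)
      then show ?thesis using e by (simp add: field_simps)
    qed
    note bound = this
    have "(\<lambda>n. expectation (W n) / \<epsilon>) \<longlonglongrightarrow> 0"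
      using tendsto_divide[OF lim tendsto_const[of \<epsilon>]] e by simp
    then have "prob (\<Inter>n. S n) \<le> 0"
      by (rule LIMSEQ_le_const) (use bound in blast)
    then have "AE \<omega> in M. \<omega> \<notin> (\<Inter>n. S n)"
      using prob_eq_0[OF T] measure_nonneg[of M "\<Inter>n. S n"] by (simp add: order_antisym)
    then show ?thesis
    proof (rule AE_mp, intro AE_I2 impI)
      fix \<omega> assume "\<omega> \<in> space M" "\<omega> \<notin> (\<Inter>n. S n)"
      then show "\<exists>n. \<forall>k\<ge>n. W k \<omega> < \<epsilon>"
        by (simp add: S_def) (metis not_le)
    qed
  qed
  have "AE \<omega> in M. \<forall>j. \<exists>n. \<forall>k\<ge>n. W k \<omega> < inverse (real (Suc j))"
    unfolding AE_all_countable by (intro allI null) simp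
  then show ?thesis
  proof (rule AE_mp, intro AE_I2 impI)
    fix \<omega> assume \<omega>: "\<omega> \<in> space M" and *: "\<forall>j. \<exists>n. \<forall>k\<ge>n. W k \<omega> < inverse (real (Suc j))"
    show "(\<lambda>n. W n \<omega>) \<longlonglongrightarrow> 0"
    proof (rule LIMSEQ_I)
      fix r :: real assume "r > 0"
      then obtain j where "inverse (real (Suc j)) < r" by (rule reals_Archimedean[THEN exE])
      moreover obtain n where "\<And>k. k \<ge> n \<Longrightarrow> W k \<omega> < inverse (real (Suc j))" using * by blast
      ultimately show "\<exists>no. \<forall>n\<ge>no. norm (W n \<omega> - 0) < r"
        using nonneg[OF \<omega>] by (intro exI[of _ n]) (force intro: less_trans)
    qed
  qed
qed

text \<open>
  The sequence \<open>e + c\<close> decreases to some \<open>l\<close>, and so \<open>e\<close> tends to \<open>l\<close>. If \<open>l\<close> were positive, the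
  decrements would eventually exceed a multiple of the terms of the divergent series \<open>\<Sum> g\<close>, whereas they telescope
  to a finite sum.
\<close>

lemma tendsto_0_if_decrease_proportional:
  fixes e g c :: "nat \<Rightarrow> real"
  assumes nonneg: "\<And>k. 0 \<le> e k" "\<And>k. 0 \<le> g k" "\<tau> > 0"
    and c: "c \<longlonglongrightarrow> 0" "\<And>k. 0 \<le> c k"
    and step: "\<And>k. e (Suc k) + c (Suc k) \<le> e k + c k - \<tau> * g k * e k"
    and div: "\<not> summable g"
  shows "e \<longlonglongrightarrow> 0"
proof -
  define w where "w k = e k + c k" for k
  have drop: "\<tau> * g k * e k \<le> w k - w (Suc k)" for k
    using step[of k] by (simp add: w_def)
  have "decseq w"
  proof (rule decseq_SucI)
    show "w (Suc k) \<le> w k" for k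
    proof -
      have "0 \<le> \<tau> * g k * e k" using nonneg by simp
      with drop[of k] show ?thesis by linarith
    qed
  qed
  moreover have "0 \<le> w k" for k using nonneg c by (simp add: w_def)
  ultimately obtain l where l: "w \<longlonglongrightarrow> l" "\<And>k. l \<le> w k"
    using decseq_convergent[of w 0] by metis
  have l0: "0 \<le> l" using LIMSEQ_le_const[OF l(1), of 0] \<open>\<And>k. 0 \<le> w k\<close> by blast
  have e_lim: "e \<longlonglongrightarrow> l"
    using tendsto_diff[OF l(1) c(1)] by (simp add: w_def)
  have "l = 0"
  proof (rule ccontr)
    assume "l \<noteq> 0"
    with l0 have lpos: "l > 0" by simp
    then have "\<forall>\<^sub>F k in sequentially. l / 2 < e k"
      by (intro order_tendstoD(1)[OF e_lim]) simp
    then have "\<forall>\<^sub>F k in sequentially. norm (\<tau> * (l / 2) * g k) \<le> w k - w (Suc k)"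
    proof eventually_elim
      case (elim k)
      have "\<tau> * (l / 2) * g k \<le> \<tau> * g k * e k"
        using elim nonneg(2)[of k] nonneg(3) mult_left_mono[of "l / 2" "e k" "\<tau> * g k"] by (simp add: mult_ac)
      then have "\<tau> * (l / 2) * g k \<le> w k - w (Suc k)"
        using drop[of k] by linarith
      moreover have "0 \<le> \<tau> * (l / 2) * g k" using nonneg lpos by simp
      ultimately show ?case by simp
    qed
    then have "summable (\<lambda>k. \<tau> * (l / 2) * g k)"
      using telescope_summable'[OF l(1)] by (rule summable_comparison_test_ev)
    then show False using div nonneg(3) lpos by (simp add: summable_cmult_iff)
  qed
  with e_lim show ?thesis by simp
qed

section \<open>Conditional expectations of matrices\<close>

lemma inner_matrix_expand:
  "A \<bullet> B = (\<Sum>i\<in>UNIV. \<Sum>j\<in>UNIV. Re (A $ i $ j) * Re (B $ i $ j) + Im (A $ i $ j) * Im (B $ i $ j))"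
  for A B :: "complex^'n^'n"
  by (simp add: inner_vec_def inner_complex_def)

text \<open>
  The real inner product is a sum of products of real and imaginary parts of entries, so the
  defining property of the scalar conditional expectation applies to each coordinate functional \<open>L\<close>.
\<close>

lemma (in prob_space) matrix_cond_exp_orthogonal:
  fixes W H :: "'a \<Rightarrow> complex^'n^'n"
  assumes sub: "subalgebra M F"
    and W: "W \<in> borel_measurable M" "AE \<omega> in M. norm (W \<omega>) \<le> C"
    and H: "H \<in> borel_measurable F" "\<And>\<omega>. \<omega> \<in> space M \<Longrightarrow> norm (H \<omega>) \<le> K"
  shows "integrable M (\<lambda>\<omega>. H \<omega> \<bullet> W \<omega>)"
    and "integrable M (\<lambda>\<omega>. H \<omega> \<bullet> matrix_cond_exp M F W \<omega>)"
    and "(\<integral>\<omega>. H \<omega> \<bullet> matrix_cond_exp M F W \<omega> \<partial>M) = (\<integral>\<omega>. H \<omega> \<bullet> W \<omega> \<partial>M)"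
proof -
  interpret S: finite_measure_subalgebra M F
    by standard (rule sub)
  have HM: "H \<in> borel_measurable M"
    using H(1) sub by (rule measurable_from_subalg[rotated])
  have comp: "integrable M (\<lambda>\<omega>. L (H \<omega>) * L (W \<omega>)) \<and>
      integrable M (\<lambda>\<omega>. L (H \<omega>) * real_cond_exp M F (\<lambda>\<omega>. L (W \<omega>)) \<omega>) \<and>
      (\<integral>\<omega>. L (H \<omega>) * real_cond_exp M F (\<lambda>\<omega>. L (W \<omega>)) \<omega> \<partial>M) = (\<integral>\<omega>. L (H \<omega>) * L (W \<omega>) \<partial>M)"
    if L: "continuous_on UNIV L" "\<And>A. \<bar>L A\<bar> \<le> norm A" for L :: "complex^'n^'n \<Rightarrow> real"
  proof -
    have meas: "(\<lambda>\<omega>. L (H \<omega>)) \<in> borel_measurable F" "(\<lambda>\<omega>. L (H \<omega>)) \<in> borel_measurable M"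
      "(\<lambda>\<omega>. L (W \<omega>)) \<in> borel_measurable M"
      using borel_measurable_continuous_onI[OF L(1)] H(1) HM W(1)
      by (auto intro: measurable_compose)
    have "integrable M (\<lambda>\<omega>. L (H \<omega>) * L (W \<omega>))"
    proof (rule integrable_const_bound)
      show "AE \<omega> in M. norm (L (H \<omega>) * L (W \<omega>)) \<le> K * C"
        using W(2)
      proof (rule AE_mp, intro AE_I2 impI)
        fix \<omega> assume "\<omega> \<in> space M" "norm (W \<omega>) \<le> C"
        then show "norm (L (H \<omega>) * L (W \<omega>)) \<le> K * C"
          using L(2)[of "H \<omega>"] L(2)[of "W \<omega>"] H(2)[of \<omega>] order_trans[OF norm_ge_zero, of "H \<omega>" K]
          by (auto simp: abs_mult intro!: mult_mono)
      qed
    qed (use meas in measurable)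
    with S.real_cond_exp_intg[OF this meas(1,3)] show ?thesis by blast
  qed
  have Re_bound: "\<bar>Re (A $ i $ j)\<bar> \<le> norm A" and Im_bound: "\<bar>Im (A $ i $ j)\<bar> \<le> norm A"
    for A :: "complex^'n^'n" and i j
    using order_trans[OF abs_Re_le_cmod order_trans[OF Finite_Cartesian_Product.norm_nth_le Finite_Cartesian_Product.norm_nth_le], of "A" i j]
      order_trans[OF abs_Im_le_cmod order_trans[OF Finite_Cartesian_Product.norm_nth_le Finite_Cartesian_Product.norm_nth_le], of "A" i j] by auto
  have R: "integrable M (\<lambda>\<omega>. Re (H \<omega> $ i $ j) * Re (W \<omega> $ i $ j)) \<and>
      integrable M (\<lambda>\<omega>. Re (H \<omega> $ i $ j) * real_cond_exp M F (\<lambda>\<omega>. Re (W \<omega> $ i $ j)) \<omega>) \<and>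
      (\<integral>\<omega>. Re (H \<omega> $ i $ j) * real_cond_exp M F (\<lambda>\<omega>. Re (W \<omega> $ i $ j)) \<omega> \<partial>M)
        = (\<integral>\<omega>. Re (H \<omega> $ i $ j) * Re (W \<omega> $ i $ j) \<partial>M)" for i j
    by (rule comp[of "\<lambda>A. Re (A $ i $ j)"]) (intro continuous_intros Re_bound)+
  have I: "integrable M (\<lambda>\<omega>. Im (H \<omega> $ i $ j) * Im (W \<omega> $ i $ j)) \<and>
      integrable M (\<lambda>\<omega>. Im (H \<omega> $ i $ j) * real_cond_exp M F (\<lambda>\<omega>. Im (W \<omega> $ i $ j)) \<omega>) \<and>
      (\<integral>\<omega>. Im (H \<omega> $ i $ j) * real_cond_exp M F (\<lambda>\<omega>. Im (W \<omega> $ i $ j)) \<omega> \<partial>M)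
        = (\<integral>\<omega>. Im (H \<omega> $ i $ j) * Im (W \<omega> $ i $ j) \<partial>M)" for i j
    by (rule comp[of "\<lambda>A. Im (A $ i $ j)"]) (intro continuous_intros Im_bound)+
  show "integrable M (\<lambda>\<omega>. H \<omega> \<bullet> W \<omega>)"
    "integrable M (\<lambda>\<omega>. H \<omega> \<bullet> matrix_cond_exp M F W \<omega>)"
    "(\<integral>\<omega>. H \<omega> \<bullet> matrix_cond_exp M F W \<omega> \<partial>M) = (\<integral>\<omega>. H \<omega> \<bullet> W \<omega> \<partial>M)"
    unfolding inner_matrix_expand matrix_cond_exp_def using R I
    by (simp_all add: Bochner_Integration.integral_sum Bochner_Integration.integral_add)
qed

section \<open>The stochastic iteration\<close>

text \<open>
  The history is generated by the primal iterates only, whereas the relative entropy is a continuous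
  function of the dual iterates. Its superlevel sets are Borel as sets of primal points because the
  Gibbs map, being continuous, sends closed sets of Hermitian matrices to \<open>\<sigma>\<close>-compact ones.
\<close>

lemma gibbs_superlevel_borel:
  fixes p :: "complex^'n^'n"
  assumes p: "p \<in> spectrahedron"
  shows "gibbs ` {Y. hermitian Y \<and> c \<le> rel_entropy p (gibbs Y)} \<in> sets borel"
proof -
  let ?H = "{Y :: complex^'n^'n. hermitian Y}"
  let ?L = "{Y \<in> ?H. c \<le> rel_entropy p (gibbs Y)}"
  have "continuous_on ?H (\<lambda>Y. neg_entropy p - p \<bullet> Y + log_partition Y)"
    by (intro continuous_intros continuous_on_log_partition)
  then have "continuous_on ?H (\<lambda>Y. rel_entropy p (gibbs Y))"
    by (rule continuous_on_cong[THEN iffD1, OF refl, rotated]) (simp add: rel_entropy_gibbs p)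
  from continuous_closed_preimage[OF this closed_hermitian, of "{c..}"]
  have L: "closed ?L" by (simp add: vimage_def Int_def)
  have "compact (gibbs ` (?L \<inter> cball 0 (real n)))" for n
    by (intro compact_continuous_image closed_Int_compact L compact_cball
        continuous_on_subset[OF continuous_on_gibbs]) auto
  then have "(\<Union>n. gibbs ` (?L \<inter> cball 0 (real n))) \<in> sets borel"
    by (intro sets.countable_UN) (auto intro: borel_closed compact_imp_closed)
  moreover have "(\<Union>n. gibbs ` (?L \<inter> cball 0 (real n))) = gibbs ` ?L"
    using real_arch_simple by (fastforce simp: image_iff)
  ultimately show ?thesis by simp
qed

context matrix_exp_learning
begin

lemma Y_hermitian:
  assumes "n \<ge> 1" "\<omega> \<in> space P"
  shows "hermitian (Y n \<omega>)"
  using assms(1)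
proof (induction n rule: dec_induct)
  case base
  then show ?case using Y_init assms(2) by auto
next
  case (step n)
  then show ?case
    using Y_step[of n \<omega>] Vhat_hermitian[of n \<omega>] assms(2)
    by (simp add: hermitian_diff hermitian_add hermitian_scaleR)
qed

lemma Y_measurable:
  assumes "n \<ge> 1"
  shows "Y n \<in> borel_measurable P"
  using assms
proof (induction n rule: dec_induct)
  case base
  obtain Y1 where "\<forall>\<omega>\<in>space P. Y 1 \<omega> = Y1" using Y_init by blast
  then show ?case by (subst measurable_cong[of _ _ "\<lambda>_. Y1"]) auto
next
  case (step n)
  have [measurable]: "Y n \<in> borel_measurable P" "Vhat n \<in> borel_measurable P"
    using step Vhat_measurable by auto
  have "(\<lambda>\<omega>. Y n \<omega> - \<gamma> n *\<^sub>R (Vhat n \<omega> + \<tau> *\<^sub>R Y n \<omega>)) \<in> borel_measurable P"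
    by measurable
  then show ?case
    using Y_step[of n] step by (subst measurable_cong[of _ _ "\<lambda>\<omega>. Y n \<omega> - \<gamma> n *\<^sub>R (Vhat n \<omega> + \<tau> *\<^sub>R Y n \<omega>)"]) auto
qed

lemma X_measurable:
  assumes n: "n \<ge> 1"
  shows "X n \<in> borel_measurable P"
proof -
  have "Y n \<in> P \<rightarrow>\<^sub>M restrict_space borel {Y. hermitian Y}"
    using Y_hermitian[OF n] Y_measurable[OF n] by (intro measurable_restrict_space2) auto
  moreover have "gibbs \<in> restrict_space borel {Y. hermitian Y} \<rightarrow>\<^sub>M borel"
    by (rule borel_measurable_continuous_on_restrict[OF continuous_on_gibbs])
  ultimately have "(\<lambda>\<omega>. gibbs (Y n \<omega>)) \<in> borel_measurable P"
    by (rule measurable_compose)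
  then show ?thesis
    using X_gibbs[OF n] by (subst measurable_cong[of _ _ "\<lambda>\<omega>. gibbs (Y n \<omega>)"]) auto
qed

lemma X_in_spectrahedron: "n \<ge> 1 \<Longrightarrow> \<omega> \<in> space P \<Longrightarrow> X n \<omega> \<in> spectrahedron"
  by (simp add: X_gibbs Y_hermitian gibbs_in_spectrahedron)

lemma space_history: "space (history P X n) = space P"
  unfolding history_def by (rule space_measure_of) auto

lemma sets_history:
  "sets (history P X n) = sigma_sets (space P) (\<Union>k\<in>{1..n}. {X k -` B \<inter> space P | B. B \<in> sets borel})"
  unfolding history_def by (rule sets_measure_of) auto

lemma subalgebra_history: "subalgebra P (history P X n)"
  unfolding subalgebra_def space_history sets_history
  by (intro conjI refl sets.sigma_sets_subset) (auto intro: measurable_sets[OF X_measurable])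

lemma sets_history_mono: "m \<le> n \<Longrightarrow> sets (history P X m) \<subseteq> sets (history P X n)"
  unfolding sets_history by (intro sigma_sets_mono') force

lemma X_vimage_history:
  assumes "k \<ge> 1" "k \<le> n" "B \<in> sets borel"
  shows "X k -` B \<inter> space P \<in> sets (history P X n)"
  unfolding sets_history using assms by (intro sigma_sets.Basic UN_I[of k]) auto

lemma X_history_measurable: "n \<ge> 1 \<Longrightarrow> X n \<in> borel_measurable (history P X n)"
  by (rule measurableI) (simp_all add: space_history X_vimage_history)

lemma rel_entropy_history_measurable:
  assumes n: "n \<ge> 1" and p: "p \<in> spectrahedron"
  shows "(\<lambda>\<omega>. rel_entropy p (X n \<omega>)) \<in> borel_measurable (history P X n)"
  unfolding borel_measurable_iff_ge space_history
proof
  fix c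
  have "{\<omega> \<in> space P. c \<le> rel_entropy p (X n \<omega>)}
      = X n -` gibbs ` {Y. hermitian Y \<and> c \<le> rel_entropy p (gibbs Y)} \<inter> space P"
    using Y_hermitian[OF n] X_gibbs[OF n] by auto
  then show "{\<omega> \<in> space P. c \<le> rel_entropy p (X n \<omega>)} \<in> sets (history P X n)"
    using X_vimage_history[OF n order_refl gibbs_superlevel_borel[OF p]] by simp
qed

lemma step_tendsto_0: "(\<lambda>n. \<gamma> (Suc n)) \<longlonglongrightarrow> 0"
proof -
  have "(\<lambda>n. (\<gamma> (Suc n))\<^sup>2) \<longlonglongrightarrow> 0"
    using summable_LIMSEQ_zero[OF step_square_summable] by simp
  then have "(\<lambda>n. sqrt ((\<gamma> (Suc n))\<^sup>2)) \<longlonglongrightarrow> sqrt 0"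
    by (rule tendsto_real_sqrt)
  then show ?thesis
    using step_pos by (simp add: less_imp_le)
qed

lemma step_not_summable: "\<not> summable (\<lambda>n. \<gamma> (Suc n))"
proof
  assume "summable (\<lambda>n. \<gamma> (Suc n))"
  then have "(\<lambda>n. \<Sum>k=1..n. \<gamma> k) \<longlonglongrightarrow> (\<Sum>n. \<gamma> (Suc n))"
    using summable_LIMSEQ by (simp add: sum.atLeast1_atMost_eq)
  with step_sum_infinite show False
    using not_tendsto_and_filterlim_at_infinity[OF sequentially_bot]
      filterlim_at_top_imp_at_infinity by blast
qed

text \<open>
  The term \<open>\<tau> Y\<close> makes the dual recursion a contraction as soon as \<open>\<gamma>\<^sub>n \<tau> < 1\<close>; from then on the bound
  \<open>max (b m) (C / \<tau>)\<close> is preserved. The finitely many earlier steps only affect the constant.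
\<close>

lemma AE_bounded:
  assumes N: "hermitian_norm N"
  shows "\<exists>C R. AE \<omega> in P. \<forall>n\<ge>1. norm (Vhat n \<omega>) \<le> C \<and> norm (Y n \<omega>) \<le> R"
proof -
  obtain c where c: "c > 0" "\<And>A. hermitian A \<Longrightarrow> norm A \<le> c * N A"
    using Frobenius_le_hermitian_norm[OF N] by blast
  obtain C0 where C0: "\<And>n. n \<ge> 1 \<Longrightarrow> AE \<omega> in P. N (Vhat n \<omega>) \<le> C0"
    using Vhat_bounded by blast
  define C where "C = \<bar>c * C0\<bar>"
  have Cpos: "0 \<le> C" by (simp add: C_def)
  have "AE \<omega> in P. norm (Vhat n \<omega>) \<le> C" if n: "n \<ge> 1" for n
    using C0[OF n]
  proof (rule AE_mp, intro AE_I2 impI)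
    fix \<omega> assume \<omega>: "\<omega> \<in> space P" "N (Vhat n \<omega>) \<le> C0"
    have "norm (Vhat n \<omega>) \<le> c * N (Vhat n \<omega>)"
      using c(2) Vhat_hermitian[OF n \<omega>(1)] by blast
    also have "\<dots> \<le> c * C0" using c(1) \<omega>(2) by simp
    finally show "norm (Vhat n \<omega>) \<le> C" by (simp add: C_def)
  qed
  then have V: "AE \<omega> in P. \<forall>n\<ge>1. norm (Vhat n \<omega>) \<le> C"
    by (simp add: AE_all_countable)
  obtain Y1 where Y1: "\<forall>\<omega>\<in>space P. Y 1 \<omega> = Y1" using Y_init by blast
  define b where "b = rec_nat (norm Y1) (\<lambda>n x. \<bar>1 - \<gamma> (Suc n) * \<tau>\<bar> * x + \<gamma> (Suc n) * C)"
  have b0: "b 0 = norm Y1" and bSuc: "b (Suc n) = \<bar>1 - \<gamma> (Suc n) * \<tau>\<bar> * b n + \<gamma> (Suc n) * C" for n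
    by (simp_all add: b_def)
  have bpos: "0 \<le> b n" for n
    using step_pos Cpos by (induction n) (auto simp: b0 bSuc less_imp_le)
  have "(\<lambda>n. \<gamma> (Suc n) * \<tau>) \<longlonglongrightarrow> 0"
    using tendsto_mult_left_zero[OF step_tendsto_0, of \<tau>] by simp
  from order_tendstoD(2)[OF this, of 1] obtain m where m: "\<And>n. n \<ge> m \<Longrightarrow> \<gamma> (Suc n) * \<tau> < 1"
    by (auto simp: eventually_sequentially)
  have bm: "b (n + m) \<le> max (b m) (C / \<tau>)" for n
  proof (induction n)
    case (Suc n)
    let ?g = "\<gamma> (Suc (n + m))" and ?K = "max (b m) (C / \<tau>)"
    have g: "0 < ?g" "?g * \<tau> < 1" using step_pos m[of "n + m"] by auto
    have "C \<le> \<tau> * ?K" using tau_pos by (simp add: max_def field_simps)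
    then have "?g * C \<le> ?g * (\<tau> * ?K)" using g by simp
    moreover have "(1 - ?g * \<tau>) * b (n + m) \<le> (1 - ?g * \<tau>) * ?K"
      using Suc g by (intro mult_left_mono) auto
    moreover have "b (Suc n + m) = (1 - ?g * \<tau>) * b (n + m) + ?g * C"
      using g bSuc[of "n + m"] by simp
    ultimately have "b (Suc n + m) \<le> (1 - ?g * \<tau>) * ?K + ?g * (\<tau> * ?K)"
      by linarith
    also have "\<dots> = ?K" by (simp add: algebra_simps)
    finally show ?case .
  qed simp
  have "Bseq (\<lambda>n. b (n + m))"
    by (rule BseqI'[of _ "max (b m) (C / \<tau>)"]) (use bm bpos in simp)
  then have "Bseq b" by (rule Bseq_offset)
  then obtain R where R: "\<And>n. norm (b n) \<le> R" unfolding Bseq_def by blast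
  have "norm (Y (Suc n) \<omega>) \<le> b n" if \<omega>: "\<omega> \<in> space P" "\<forall>n\<ge>1. norm (Vhat n \<omega>) \<le> C" for n \<omega>
  proof (induction n)
    case 0
    then show ?case using Y1 \<omega>(1) by (simp add: b0)
  next
    case (Suc n)
    let ?g = "\<gamma> (Suc n)"
    have "Y (Suc (Suc n)) \<omega> = (1 - ?g * \<tau>) *\<^sub>R Y (Suc n) \<omega> - ?g *\<^sub>R Vhat (Suc n) \<omega>"
      using Y_step[of "Suc n" \<omega>] \<omega>(1) by (simp add: algebra_simps)
    then have "norm (Y (Suc (Suc n)) \<omega>) \<le> \<bar>1 - ?g * \<tau>\<bar> * norm (Y (Suc n) \<omega>) + ?g * norm (Vhat (Suc n) \<omega>)"
      using norm_triangle_ineq4[of "(1 - ?g * \<tau>) *\<^sub>R Y (Suc n) \<omega>" "?g *\<^sub>R Vhat (Suc n) \<omega>"] step_pos[of "Suc n"]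
      by simp
    also have "\<dots> \<le> b (Suc n)"
      unfolding bSuc using Suc \<omega>(2) step_pos[of "Suc n"] by (intro add_mono mult_left_mono) auto
    finally show ?case .
  qed
  then have Yb: "norm (Y n \<omega>) \<le> R" if prems: "\<omega> \<in> space P" "\<forall>n\<ge>1. norm (Vhat n \<omega>) \<le> C" "n \<ge> 1" for n \<omega>
  proof -
    obtain k where n: "n = Suc k" using prems(3) by (cases n) auto
    have "b k \<le> R" using R[of k] by simp
    with \<open>\<And>n \<omega>. \<omega> \<in> space P \<Longrightarrow> \<forall>n\<ge>1. norm (Vhat n \<omega>) \<le> C \<Longrightarrow> norm (Y (Suc n) \<omega>) \<le> b n\<close>[OF prems(1,2), of k]
    show ?thesis unfolding n by linarith
  qed
  have "AE \<omega> in P. \<forall>n\<ge>1. norm (Vhat n \<omega>) \<le> C \<and> norm (Y n \<omega>) \<le> R"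
    using V AE_space
  proof eventually_elim
    case (elim \<omega>)
    then show ?case using Yb[OF elim(2,1)] by blast
  qed
  then show ?thesis by blast
qed

text \<open>
  With \<open>D k\<close> the relative entropy of \<open>p\<close> from the iterate, the three-point identity and the drift
  estimate give \<open>E[D (k+1); A] \<le> (1 - \<tau> \<gamma>) E[D k; A] + \<gamma>\<^sup>2 B P(A)\<close> for events \<open>A\<close> of the history. Taking
  for \<open>A\<close> the whole space shows that the expectations tend to zero; adding the tail \<open>c k\<close> of the error
  series turns \<open>D\<close> into a nonnegative supermartingale, and the maximal inequality does the rest.
\<close>

theorem AE_tendsto_equilibrium:
  assumes N: "hermitian_norm N" and conv: "convex_on spectrahedron g"
    and grad: "is_gradient g G" "is_gradient g V" and p: "gibbs_equilibrium G \<tau> p"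
  shows "AE \<omega> in P. (\<lambda>n. X n \<omega>) \<longlonglongrightarrow> p"
proof -
  obtain C R where CR: "AE \<omega> in P. \<forall>n\<ge>1. norm (Vhat n \<omega>) \<le> C \<and> norm (Y n \<omega>) \<le> R"
    using AE_bounded[OF N] by blast
  have pS: "p \<in> spectrahedron" using p by (simp add: gibbs_equilibrium_def)
  obtain Y0 where Y0: "hermitian Y0" "gibbs Y0 = p"
    using p hermitian_scaleR[OF is_gradient_hermitian[OF grad(1) pS]] by (metis gibbs_equilibrium_def)
  obtain K where K: "\<And>A :: complex^'n^'n. A \<in> spectrahedron \<Longrightarrow> norm A \<le> K"
    using compact_imp_bounded[OF compact_spectrahedron] unfolding bounded_iff by blast
  define B where "B = (C + \<tau> * R)\<^sup>2"
  \<comment> \<open>Everything is shifted by one, as time starts at \<open>1\<close>.\<close>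
  define D where "D k \<omega> = rel_entropy p (X (Suc k) \<omega>)" for k \<omega>
  define F where "F k = history P X (Suc k)" for k
  define \<gamma>' where "\<gamma>' k = \<gamma> (Suc k)" for k
  define E where "E k = matrix_cond_exp P (F k) (Vhat (Suc k))" for k
  have g_pos: "0 < \<gamma>' k" for k by (simp add: \<gamma>'_def step_pos)
  have sub: "subalgebra P (F k)" for k by (simp add: F_def subalgebra_history)
  have D_F: "D k \<in> borel_measurable (F k)" for k
    unfolding D_def F_def by (rule rel_entropy_history_measurable[OF _ pS]) simp
  have D_M: "D k \<in> borel_measurable P" for k
    by (rule measurable_from_subalg[OF sub D_F])
  have D_nonneg: "0 \<le> D k \<omega>" if "\<omega> \<in> space P" for k \<omega>
    using that by (simp add: D_def X_gibbs rel_entropy_gibbs_nonneg pS Y_hermitian)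
  have D_int: "integrable P (D k)" for k
  proof (rule integrable_const_bound[where B = "(norm Y0 + R)\<^sup>2"])
    show "AE \<omega> in P. norm (D k \<omega>) \<le> (norm Y0 + R)\<^sup>2"
      using CR
    proof (rule AE_mp, intro AE_I2 impI)
      fix \<omega> assume \<omega>: "\<omega> \<in> space P" "\<forall>n\<ge>1. norm (Vhat n \<omega>) \<le> C \<and> norm (Y n \<omega>) \<le> R"
      have "D k \<omega> \<le> (norm (Y0 - Y (Suc k) \<omega>))\<^sup>2"
        using rel_entropy_gibbs_le[OF Y0(1) Y_hermitian[of "Suc k" \<omega>]] \<omega>(1) by (simp add: D_def X_gibbs Y0)
      also have "\<dots> \<le> (norm Y0 + R)\<^sup>2"
      proof (rule power_mono)
        have "norm (Y (Suc k) \<omega>) \<le> R" using \<omega>(2) by simp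
        then show "norm (Y0 - Y (Suc k) \<omega>) \<le> norm Y0 + R"
          using norm_triangle_ineq4[of Y0 "Y (Suc k) \<omega>"] by linarith
      qed simp
      finally show "norm (D k \<omega>) \<le> (norm Y0 + R)\<^sup>2" using D_nonneg[OF \<omega>(1)] by simp
    qed
  qed (rule D_M)
  have step: "AE \<omega> in P. D (Suc k) \<omega> \<le> (1 - \<tau> * \<gamma>' k) * D k \<omega>
      - \<gamma>' k * ((X (Suc k) \<omega> - p) \<bullet> Vhat (Suc k) \<omega> - (X (Suc k) \<omega> - p) \<bullet> E k \<omega>) + (\<gamma>' k)\<^sup>2 * B" for k
  proof -
    have "AE \<omega> in P. E k \<omega> = V (X (Suc k) \<omega>)"
      using Vhat_unbiased[of "Suc k"] by (simp add: E_def F_def)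
    with CR AE_space show ?thesis
    proof eventually_elim
      case (elim \<omega>)
      let ?Y = "Y (Suc k) \<omega>" and ?Y' = "Y (Suc (Suc k)) \<omega>" and ?V = "Vhat (Suc k) \<omega>" and ?g = "\<gamma>' k"
      have Yh: "hermitian ?Y" "hermitian ?Y'" using Y_hermitian elim by auto
      have X: "X (Suc k) \<omega> = gibbs ?Y" "X (Suc (Suc k)) \<omega> = gibbs ?Y'"
        using X_gibbs elim by auto
      have diff: "?Y' - ?Y = - (?g *\<^sub>R (?V + \<tau> *\<^sub>R ?Y))"
        using Y_step[of "Suc k" \<omega>] elim by (simp add: \<gamma>'_def)
      have "norm (?V + \<tau> *\<^sub>R ?Y) \<le> norm ?V + \<tau> * norm ?Y"
        using norm_triangle_ineq[of ?V "\<tau> *\<^sub>R ?Y"] tau_pos by simp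
      also have "\<dots> \<le> C + \<tau> * R"
        using elim tau_pos by (intro add_mono mult_left_mono) auto
      finally have "(norm (?V + \<tau> *\<^sub>R ?Y))\<^sup>2 \<le> B"
        unfolding B_def by (intro power_mono) auto
      then have quad: "(norm (?Y - ?Y'))\<^sup>2 \<le> ?g\<^sup>2 * B"
        unfolding norm_minus_commute[of ?Y] diff by (simp add: power_mult_distrib mult_left_mono)
      have "D (Suc k) \<omega> \<le> D k \<omega> - ?g * ((?V + \<tau> *\<^sub>R ?Y) \<bullet> (gibbs ?Y - p)) + ?g\<^sup>2 * B"
        using rel_entropy_three_point[OF pS Yh] rel_entropy_gibbs_le[OF Yh] quad
        unfolding diff by (simp add: D_def X)
      moreover have "?g * (\<tau> * D k \<omega>) \<le> ?g * ((E k \<omega> + \<tau> *\<^sub>R ?Y) \<bullet> (gibbs ?Y - p))"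
        using gibbs_equilibrium_drift[OF conv grad tau_pos p Yh(1)] elim g_pos[of k]
        by (simp add: D_def X)
      ultimately show ?case
        unfolding X inner_commute[of "gibbs ?Y - p"] by (simp add: inner_add_left algebra_simps)
    qed
  qed
  have super: "(\<integral>\<omega>. indicator A \<omega> * D (Suc k) \<omega> \<partial>P)
      \<le> (1 - \<tau> * \<gamma>' k) * (\<integral>\<omega>. indicator A \<omega> * D k \<omega> \<partial>P) + (\<gamma>' k)\<^sup>2 * B * prob A"
    if A: "A \<in> sets (F k)" for A k
  proof -
    have AM: "A \<in> sets P" using A sub[of k] by (auto simp: subalgebra_def)
    \<comment> \<open>Known at time \<open>k\<close>, hence uncorrelated with the noise in the gradient estimate.\<close>
    define H where "H \<omega> = indicat_real A \<omega> *\<^sub>R (X (Suc k) \<omega> - p)" for \<omega>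
    have [measurable]: "X (Suc k) \<in> borel_measurable (F k)" "A \<in> sets (F k)"
      using X_history_measurable[of "Suc k"] A by (simp_all add: F_def)
    have HF: "H \<in> borel_measurable (F k)" unfolding H_def by measurable
    have H_bound: "norm (H \<omega>) \<le> K + K" if "\<omega> \<in> space P" for \<omega>
    proof -
      have "norm (H \<omega>) \<le> norm (X (Suc k) \<omega> - p)" by (simp add: H_def split: split_indicator)
      also have "\<dots> \<le> norm (X (Suc k) \<omega>) + norm p" by (rule norm_triangle_ineq4)
      also have "\<dots> \<le> K + K" using that by (intro add_mono K pS X_in_spectrahedron) auto
      finally show ?thesis .
    qed
    have V_bound: "AE \<omega> in P. norm (Vhat (Suc k) \<omega>) \<le> C"
      using CR by eventually_elim auto
    note orth = matrix_cond_exp_orthogonal[OF sub Vhat_measurable V_bound HF H_bound, folded E_def, simplified]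
    have ints: "integrable P (\<lambda>\<omega>. indicator A \<omega> * D j \<omega>)" for j
      using integrable_mult_indicator[OF AM D_int[of j]] by simp
    have intA: "integrable P (indicat_real A)"
      using AM by (intro integrable_real_indicator) (auto simp: emeasure_eq_measure)
    have "(\<integral>\<omega>. indicator A \<omega> * D (Suc k) \<omega> \<partial>P) \<le> (\<integral>\<omega>. (1 - \<tau> * \<gamma>' k) * (indicator A \<omega> * D k \<omega>)
        - \<gamma>' k * (H \<omega> \<bullet> Vhat (Suc k) \<omega> - H \<omega> \<bullet> E k \<omega>) + (\<gamma>' k)\<^sup>2 * B * indicator A \<omega> \<partial>P)"
    proof (rule integral_mono_AE)
      show "AE \<omega> in P. indicator A \<omega> * D (Suc k) \<omega> \<le> (1 - \<tau> * \<gamma>' k) * (indicator A \<omega> * D k \<omega>)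
        - \<gamma>' k * (H \<omega> \<bullet> Vhat (Suc k) \<omega> - H \<omega> \<bullet> E k \<omega>) + (\<gamma>' k)\<^sup>2 * B * indicator A \<omega>"
        using step[of k] by eventually_elim (simp add: H_def split: split_indicator)
    qed (intro Bochner_Integration.integrable_add Bochner_Integration.integrable_diff
        integrable_mult_right ints intA orth)+
    also have "\<dots> = (1 - \<tau> * \<gamma>' k) * (\<integral>\<omega>. indicator A \<omega> * D k \<omega> \<partial>P)
        - \<gamma>' k * ((\<integral>\<omega>. H \<omega> \<bullet> Vhat (Suc k) \<omega> \<partial>P) - (\<integral>\<omega>. H \<omega> \<bullet> E k \<omega> \<partial>P)) + (\<gamma>' k)\<^sup>2 * B * prob A"
      using ints[of k] intA orth AM by simp
    also have "(\<integral>\<omega>. H \<omega> \<bullet> E k \<omega> \<partial>P) = (\<integral>\<omega>. H \<omega> \<bullet> Vhat (Suc k) \<omega> \<partial>P)"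
      by (rule orth)
    finally show ?thesis by simp
  qed
  \<comment> \<open>The compensator: the total second-order error still to come.\<close>
  define c where "c k = B * (\<Sum>i. (\<gamma>' (i + k))\<^sup>2)" for k
  have g_summable: "summable (\<lambda>i. (\<gamma>' (i + k))\<^sup>2)" for k
    using summable_ignore_initial_segment[OF step_square_summable, of k] by (simp add: \<gamma>'_def)
  have c_Suc: "c k = (\<gamma>' k)\<^sup>2 * B + c (Suc k)" for k
  proof -
    have "(\<Sum>i. (\<gamma>' (i + k))\<^sup>2) = (\<gamma>' k)\<^sup>2 + (\<Sum>i. (\<gamma>' (i + Suc k))\<^sup>2)"
      using suminf_split_head[OF g_summable[of k]] by simp
    then show ?thesis unfolding c_def by (simp only: distrib_left mult.commute)
  qed
  have c_nonneg: "0 \<le> c k" for k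
    unfolding c_def B_def by (intro mult_nonneg_nonneg suminf_nonneg g_summable) auto
  have c_lim: "c \<longlonglongrightarrow> 0"
  proof -
    have "(\<lambda>k. (\<Sum>i. (\<gamma>' i)\<^sup>2) - (\<Sum>i<k. (\<gamma>' i)\<^sup>2)) \<longlonglongrightarrow> (\<Sum>i. (\<gamma>' i)\<^sup>2) - (\<Sum>i. (\<gamma>' i)\<^sup>2)"
      using g_summable[of 0] by (intro tendsto_intros summable_LIMSEQ) simp
    then have "(\<lambda>k. B * (\<Sum>i. (\<gamma>' (i + k))\<^sup>2)) \<longlonglongrightarrow> B * 0"
      using suminf_minus_initial_segment[OF g_summable[of 0, simplified]]
      by (intro tendsto_intros) simp
    then show ?thesis by (simp add: c_def[abs_def])
  qed
  define W where "W k \<omega> = D k \<omega> + c k" for k \<omega>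
  have D_indicator_nonneg: "0 \<le> (\<integral>\<omega>. indicator A \<omega> * D k \<omega> \<partial>P)" for A k
    using D_nonneg by (intro Bochner_Integration.integral_nonneg_AE AE_I2) (auto split: split_indicator)
  have D_expectation: "expectation (D k) = (\<integral>\<omega>. indicator (space P) \<omega> * D k \<omega> \<partial>P)" for k
    by (intro Bochner_Integration.integral_cong) auto
  have "(\<lambda>k. expectation (D k)) \<longlonglongrightarrow> 0"
  proof (rule tendsto_0_if_decrease_proportional[OF _ _ tau_pos c_lim c_nonneg])
    show "0 \<le> expectation (D k)" for k unfolding D_expectation by (rule D_indicator_nonneg)
    show "0 \<le> \<gamma>' k" for k using g_pos[of k] by simp
    show "expectation (D (Suc k)) + c (Suc k) \<le> expectation (D k) + c k - \<tau> * \<gamma>' k * expectation (D k)" for k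
    proof -
      have "space P \<in> sets (F k)"
        by (metis F_def sets.top space_history)
      from super[OF this] show ?thesis
        using c_Suc[of k] unfolding D_expectation by (simp add: prob_space algebra_simps)
    qed
    show "\<not> summable \<gamma>'" using step_not_summable by (simp add: \<gamma>'_def[abs_def])
  qed
  then have "(\<lambda>k. expectation (D k) + c k) \<longlonglongrightarrow> 0 + 0"
    by (intro tendsto_add c_lim)
  then have W_lim: "(\<lambda>k. expectation (W k)) \<longlonglongrightarrow> 0"
    using D_int by (simp add: W_def[abs_def] prob_space)
  have "AE \<omega> in P. (\<lambda>k. W k \<omega>) \<longlonglongrightarrow> 0"
  proof (rule supermartingale_AE_tendsto_0[OF sub])
    show "sets (F k) \<subseteq> sets (F (Suc k))" for k
      unfolding F_def by (rule sets_history_mono) simp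
    show "W k \<in> borel_measurable (F k)" for k
      unfolding W_def using D_F[of k] by measurable
    show "integrable P (W k)" for k
      unfolding W_def using D_int[of k] by simp
    show "0 \<le> W k \<omega>" if "\<omega> \<in> space P" for k \<omega>
      using D_nonneg[OF that] c_nonneg by (simp add: W_def)
    fix k A assume A: "A \<in> sets (F k)"
    then have AM: "A \<in> sets P" using sub[of k] by (auto simp: subalgebra_def)
    have W_int: "(\<integral>\<omega>. indicator A \<omega> * W j \<omega> \<partial>P) = (\<integral>\<omega>. indicator A \<omega> * D j \<omega> \<partial>P) + c j * prob A" for j
    proof -
      have "integrable P (\<lambda>\<omega>. indicator A \<omega> * D j \<omega>)"
        using integrable_mult_indicator[OF AM D_int[of j]] by simp
      moreover have "integrable P (\<lambda>\<omega>. c j * indicator A \<omega>)"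
        using AM by (intro integrable_mult_right integrable_real_indicator) (auto simp: emeasure_eq_measure)
      ultimately have "(\<integral>\<omega>. indicator A \<omega> * D j \<omega> + c j * indicator A \<omega> \<partial>P)
          = (\<integral>\<omega>. indicator A \<omega> * D j \<omega> \<partial>P) + c j * prob A"
        using AM by simp
      then show ?thesis by (simp add: W_def distrib_left mult.commute)
    qed
    have "0 \<le> \<tau> * \<gamma>' k * (\<integral>\<omega>. indicator A \<omega> * D k \<omega> \<partial>P)"
      using tau_pos g_pos[of k] D_indicator_nonneg by simp
    then have "(1 - \<tau> * \<gamma>' k) * (\<integral>\<omega>. indicator A \<omega> * D k \<omega> \<partial>P) \<le> (\<integral>\<omega>. indicator A \<omega> * D k \<omega> \<partial>P)"
      by (simp add: left_diff_distrib)
    with super[OF A] show "(\<integral>\<omega>. indicator A \<omega> * W (Suc k) \<omega> \<partial>P) \<le> (\<integral>\<omega>. indicator A \<omega> * W k \<omega> \<partial>P)"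
      unfolding W_int c_Suc[of k] distrib_right by linarith
  qed (rule W_lim)
  then show ?thesis
    using AE_space
  proof eventually_elim
    case (elim \<omega>)
    have "(\<lambda>k. W k \<omega> - c k) \<longlonglongrightarrow> 0 - 0"
      using elim by (intro tendsto_diff c_lim) auto
    then have "(\<lambda>k. sqrt (2 * D k \<omega>)) \<longlonglongrightarrow> sqrt (2 * 0)"
      by (intro tendsto_intros) (simp add: W_def)
    then have lim: "(\<lambda>k. sqrt (2 * D k \<omega>)) \<longlonglongrightarrow> 0" by simp
    have "norm (X (Suc k) \<omega> - p) \<le> sqrt (2 * D k \<omega>)" for k
      using rel_entropy_gibbs_lower_bound[OF pS Y_hermitian[of "Suc k" \<omega>]] elim
      by (intro real_le_rsqrt) (simp add: D_def X_gibbs norm_minus_commute)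
    then have "(\<lambda>k. X (Suc k) \<omega> - p) \<longlonglongrightarrow> 0"
      by (intro Lim_null_comparison[OF _ lim]) simp
    then have "(\<lambda>k. X (Suc k) \<omega>) \<longlonglongrightarrow> p"
      by (simp add: LIM_zero_iff)
    then show ?case by (rule LIMSEQ_imp_Suc)
  qed
qed

end

section \<open>Convergence of matrix exponential learning\<close>

lemma convex_on_mean_objective:
  fixes f :: "complex^'n^'n \<Rightarrow> 'w \<Rightarrow> real"
  assumes "prob_space D"
    and "\<And>w. w \<in> space D \<Longrightarrow> convex_on spectrahedron (\<lambda>X. f X w)"
    and int: "\<And>X. X \<in> spectrahedron \<Longrightarrow> integrable D (f X)"
  shows "convex_on spectrahedron (mean_objective D f)"
proof (rule convex_onI)
  fix t :: real and X Y :: "complex^'n^'n" assume t: "0 < t" "t < 1" and XY: "X \<in> spectrahedron" "Y \<in> spectrahedron"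
  have "mean_objective D f ((1 - t) *\<^sub>R X + t *\<^sub>R Y) \<le> (\<integral>w. (1 - t) * f X w + t * f Y w \<partial>D)"
    unfolding mean_objective_def
  proof (rule integral_mono)
    show "integrable D (f ((1 - t) *\<^sub>R X + t *\<^sub>R Y))"
      using convexD_alt[OF convex_spectrahedron XY, of t] t by (intro int) simp
    show "integrable D (\<lambda>w. (1 - t) * f X w + t * f Y w)"
      using int[OF XY(1)] int[OF XY(2)] by simp
    show "f ((1 - t) *\<^sub>R X + t *\<^sub>R Y) w \<le> (1 - t) * f X w + t * f Y w" if "w \<in> space D" for w
      using convex_onD[OF assms(2)[OF that], of t X Y] t XY by simp
  qed
  also have "\<dots> = (1 - t) * mean_objective D f X + t * mean_objective D f Y"
    using int[OF XY(1)] int[OF XY(2)] by (simp add: mean_objective_def)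
  finally show "mean_objective D f ((1 - t) *\<^sub>R X + t *\<^sub>R Y)
      \<le> (1 - t) * mean_objective D f X + t * mean_objective D f Y" .
qed (rule convex_spectrahedron)

theorem theorem3p1:
  fixes D :: "'w measure"
    and f :: "complex^'n^'n \<Rightarrow> 'w \<Rightarrow> real"
    and V :: "complex^'n^'n \<Rightarrow> complex^'n^'n"
    and N :: "complex^'n^'n \<Rightarrow> real"
  assumes "prob_space D"
    and "\<And>w. w \<in> space D \<Longrightarrow> smooth_on_spectrahedron (\<lambda>X. f X w)"
    and "\<And>w. w \<in> space D \<Longrightarrow> convex_on spectrahedron (\<lambda>X. f X w)"
    and "\<And>X. X \<in> spectrahedron \<Longrightarrow> integrable D (f X)"
    and "smooth_on_spectrahedron (mean_objective D f)"
    and "is_gradient (mean_objective D f) V"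
    and "hermitian_norm N"
  shows "(\<forall>(P :: 'a measure) \<tau> \<gamma> Vhat Y X. matrix_exp_learning P N V \<tau> \<gamma> Vhat Y X \<longrightarrow>
            (AE \<omega> in P. \<exists>Z.
               is_arg_min (\<lambda>X. mean_objective D f X + \<tau> * neg_entropy X)
                 (\<lambda>X. X \<in> spectrahedron) Z \<and>
               (\<lambda>n. X n \<omega>) \<longlonglongrightarrow> Z)) \<and>
         (\<exists>\<epsilon> :: real \<Rightarrow> real. (\<epsilon> \<longlongrightarrow> 0) (at_right 0) \<and>
            (\<forall>(P :: 'a measure) \<tau> \<gamma> Vhat Y X. matrix_exp_learning P N V \<tau> \<gamma> Vhat Y X \<longrightarrow>
               (AE \<omega> in P. \<exists>Z S.
                  (\<lambda>n. X n \<omega>) \<longlonglongrightarrow> Z \<and>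
                  is_arg_min (mean_objective D f) (\<lambda>X. X \<in> spectrahedron) S \<and>
                  N (Z - S) \<le> \<epsilon> \<tau>)))"
proof -
  let ?F = "mean_objective D f"
  let ?M = "{S. is_arg_min ?F (\<lambda>X. X \<in> spectrahedron) S}"
  have conv: "convex_on spectrahedron ?F"
    by (rule convex_on_mean_objective) (fact assms)+
  obtain G where G: "is_gradient ?F G" "continuous_on spectrahedron G"
    using assms(5) by (auto simp: smooth_on_spectrahedron_def)
  \<comment> \<open>One equilibrium per temperature, chosen independently of the probability space and of the
    run, so that \<open>\<epsilon>\<close> below depends on \<open>\<tau>\<close> alone.\<close>
  define p where "p \<tau> = (SOME p. gibbs_equilibrium G \<tau> p)" for \<tau>
  have p: "gibbs_equilibrium G \<tau> (p \<tau>)" for \<tau>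
    unfolding p_def
    by (rule someI_ex[OF gibbs_equilibrium_exists[OF G(2) is_gradient_hermitian[OF G(1)]]])
  have pS: "p \<tau> \<in> spectrahedron" for \<tau>
    using p by (simp add: gibbs_equilibrium_def)
  have pmin: "?F (p \<tau>) + \<tau> * neg_entropy (p \<tau>) \<le> ?F X + \<tau> * neg_entropy X"
    if "\<tau> > 0" "X \<in> spectrahedron" for \<tau> X
    by (rule gibbs_equilibrium_minimises[OF conv G(1) that(1) p that(2)])
  have lim: "AE \<omega> in P. (\<lambda>n. X n \<omega>) \<longlonglongrightarrow> p \<tau>"
    if "matrix_exp_learning P N V \<tau> \<gamma> Vhat Y X" for P :: "'a measure" and \<tau> \<gamma> Vhat Y X
    by (rule matrix_exp_learning.AE_tendsto_equilibrium[OF that assms(7) conv G(1) assms(6) p])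
  have nonempty: "(spectrahedron :: (complex^'n^'n) set) \<noteq> {}"
    using pS by blast
  have cont: "continuous_on spectrahedron ?F"
    by (rule is_gradient_continuous_on[OF G(1)])
  obtain K where K: "K > 0" "\<And>A. hermitian A \<Longrightarrow> N A \<le> K * norm A"
    using hermitian_norm_le_Frobenius[OF assms(7)] by blast
  define \<epsilon> where "\<epsilon> \<tau> = K * infdist (p \<tau>) ?M" for \<tau>
  have h_bound: "\<bar>neg_entropy X\<bar> \<le> \<bar>log_partition (0 :: complex^'n^'n)\<bar>" if "X \<in> spectrahedron" for X :: "complex^'n^'n"
    using neg_entropy_nonpos[OF that] neg_entropy_ge[OF that] by simp
  have "((\<lambda>\<tau>. infdist (p \<tau>) ?M) \<longlongrightarrow> 0) (at_right 0)"
    by (rule perturbed_minimisers_approach_argmin[OF compact_spectrahedron nonempty cont h_bound pS pmin])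
  then have eps: "(\<epsilon> \<longlongrightarrow> 0) (at_right 0)"
    unfolding \<epsilon>_def by (rule tendsto_mult_right_zero)
  have near: "\<exists>S. is_arg_min ?F (\<lambda>X. X \<in> spectrahedron) S \<and> N (p \<tau> - S) \<le> \<epsilon> \<tau>" for \<tau>
  proof -
    obtain S where S: "S \<in> ?M" "infdist (p \<tau>) ?M = dist (p \<tau>) S"
      using infdist_attains_inf argmin_closed_nonempty[OF compact_spectrahedron nonempty cont] by blast
    have "S \<in> spectrahedron" using S(1) by (simp add: is_arg_min_def)
    then have "N (p \<tau> - S) \<le> \<epsilon> \<tau>"
      using K(2)[of "p \<tau> - S"] pS S(2)
      by (simp add: \<epsilon>_def dist_norm hermitian_diff spectrahedron_hermitian)
    with S(1) show ?thesis by blast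
  qed
  show ?thesis
  proof (intro conjI exI[of _ \<epsilon>] allI impI eps)
    fix P :: "'a measure" and \<tau> \<gamma> Vhat Y X
    assume run: "matrix_exp_learning P N V \<tau> \<gamma> Vhat Y X"
    then have tau: "\<tau> > 0" by (rule matrix_exp_learning.tau_pos)
    have "is_arg_min (\<lambda>X. ?F X + \<tau> * neg_entropy X) (\<lambda>X. X \<in> spectrahedron) (p \<tau>)"
      using pS pmin[OF tau] by (simp add: is_arg_min_linorder)
    with lim[OF run] show "AE \<omega> in P. \<exists>Z.
        is_arg_min (\<lambda>X. ?F X + \<tau> * neg_entropy X) (\<lambda>X. X \<in> spectrahedron) Z \<and> (\<lambda>n. X n \<omega>) \<longlonglongrightarrow> Z"
      by (auto elim: eventually_mono)
  next
    fix P :: "'a measure" and \<tau> \<gamma> Vhat Y X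
    assume run: "matrix_exp_learning P N V \<tau> \<gamma> Vhat Y X"
    obtain S where "is_arg_min ?F (\<lambda>X. X \<in> spectrahedron) S" "N (p \<tau> - S) \<le> \<epsilon> \<tau>"
      using near by blast
    with lim[OF run] show "AE \<omega> in P. \<exists>Z S. (\<lambda>n. X n \<omega>) \<longlonglongrightarrow> Z \<and>
        is_arg_min ?F (\<lambda>X. X \<in> spectrahedron) S \<and> N (Z - S) \<le> \<epsilon> \<tau>"
      by (auto elim: eventually_mono)
  qed
qed

end
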